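(* Let $p$ be a prime, let $s\in\mathbb N$, let $m_1,\ldots,m_s$ be positive integers, and let $k,n_1,\ldots,n_s$ be nonnegative integers with $k\leq n_i$ for all $i$. Write $M=m_1+\cdots+m_s$ and $D=n_1m_1+\cdots+n_sm_s-Mk$. Then $$\int_{\mathbb Z_p}B_{k,n_1}^{m_1}(x)B_{k,n_2}^{m_2}(x)\cdots B_{k,n_s}^{m_s}(x)\,d\mu_1(x)=\binom{n_1}{k}^{m_1}\binom{n_2}{k}^{m_2}\cdots\binom{n_s}{k}^{m_s}\sum_{l=0}^{D}(-1)^{l}\binom{D}{l}B_{Mk+l}.$$
   Context: For integers $0\leq k\leq n$, the Bernstein polynomial is $B_{k,n}(x)=\binom{n}{k}x^k(1-x)^{n-k}$, and $B_{k,n}^{m}(x)$ denotes the $m$-fold product $B_{k,n}(x)\cdots B_{k,n}(x)$. $\mathbb Z_p$ denotes the ring of $p$-adic integers, and for a uniformly differentiable $f:\mathbb Z_p\to\mathbb C_p$ the bosonic $p$-adic (Volkenborn) integral is $\int_{\mathbb Z_p}f(x)\,d\mu_1(x)=\lim_{N\to\infty}\frac{1}{p^N}\sum_{x=0}^{p^N-1}f(x)$. $B_m$ denotes the $m$-th Bernoulli number, defined by $\frac{t}{e^t-1}=\sum_{m\geq0}B_m\frac{t^m}{m!}$; one has $\int_{\mathbb Z_p}x^m\,d\mu_1(x)=B_m$. *)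

theory Defs
  imports
    Complex_Main
    "HOL-Algebra.Algebraic_Closure_Type"
    "HOL-Computational_Algebra.Formal_Power_Series"
    "Berlekamp_Zassenhaus.Finite_Field"
begin

section \<open>Non-Archimedean valued fields\<close>

lemma ultrametric_imp_triangle2:
  fixes v :: "'a :: field \<Rightarrow> real"
  assumes ge0: "\<And>x. v x \<ge> 0" and eq0: "\<And>x. v x = 0 \<longleftrightarrow> x = 0"
    and mult: "\<And>x y. v (x * y) = v x * v y"
    and add: "\<And>x y. v (x + y) \<le> max (v x) (v y)"
  shows "v (x - y) \<le> v (x - z) + v (y - z)"
proof -
  have "v 1 = 1"
    using mult[of 1 1] by (simp add: eq0)
  hence "v (-1) ^ 2 = 1"
    using mult[of "-1" "-1"] by (simp add: power2_eq_square)
  hence "v (-1) = 1"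
    using ge0[of "-1"] by (auto simp: power2_eq_1_iff)
  hence "v (z - y) = v (y - z)"
    using mult[of "-1" "y - z"] by simp
  moreover have "v (x - y) \<le> max (v (x - z)) (v (z - y))"
    using add[of "x - z" "z - y"] by simp
  ultimately show ?thesis
    using ge0[of "x - z"] ge0[of "y - z"] by simp
qed

class nonarch_field = field + metric_space +
  fixes absv :: "'a \<Rightarrow> real"
  assumes absv_ge_0 [simp]: "0 \<le> absv x"
    and absv_eq_0_iff [simp]: "absv x = 0 \<longleftrightarrow> x = 0"
    and absv_mult: "absv (x * y) = absv x * absv y"
    and absv_add_le_max: "absv (x + y) \<le> max (absv x) (absv y)"
    and dist_absv: "dist x y = absv (x - y)"
begin

lemma absv_0 [simp]: "absv 0 = 0"
  by simp

lemma absv_pos_iff [simp]: "0 < absv x \<longleftrightarrow> x \<noteq> 0"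
  by (simp add: order.strict_iff_order)

lemma absv_1 [simp]: "absv 1 = 1"
  using absv_mult[of 1 1] by simp

lemma absv_minus [simp]: "absv (- x) = absv x"
proof -
  have "absv (-1) * absv (-1) = 1"
    by (simp flip: absv_mult)
  hence "(absv (-1) - 1) * (absv (-1) + 1) = 0"
    by (simp add: algebra_simps)
  moreover have "absv (-1) + 1 \<noteq> 0"
    using absv_ge_0[of "-1"] by linarith
  ultimately have "absv (-1) = 1"
    by simp
  thus ?thesis
    using absv_mult[of "-1" x] by simp
qed

lemma absv_minus_commute: "absv (x - y) = absv (y - x)"
  using absv_minus[of "x - y"] by simp

lemma absv_triangle: "absv (x + y) \<le> absv x + absv y"
  using absv_add_le_max[of x y] absv_ge_0[of x] absv_ge_0[of y] by linarith

lemma absv_diff_triangle: "\<bar>absv x - absv y\<bar> \<le> absv (x - y)"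
  using absv_triangle[of "x - y" y] absv_triangle[of "y - x" x] absv_minus_commute[of x y]
  by simp

lemma absv_power: "absv (x ^ n) = absv x ^ n"
  by (induction n) (auto simp: absv_mult)

end

lemma absv_inverse: "absv (inverse x) = inverse (absv (x :: 'a :: nonarch_field))"
proof (cases "x = 0")
  case False
  hence "absv x * absv (inverse x) = 1"
    by (simp flip: absv_mult)
  thus ?thesis
    by (rule inverse_unique[symmetric])
qed auto

lemma absv_divide: "absv (x / y) = absv x / absv (y :: 'a :: nonarch_field)"
  by (simp add: divide_inverse absv_mult absv_inverse)

lemma Cauchy_absv_iff:
  fixes F :: "nat \<Rightarrow> 'a :: nonarch_field"
  shows "Cauchy F \<longleftrightarrow> (\<forall>e>0. \<exists>M. \<forall>m\<ge>M. \<forall>n\<ge>M. absv (F m - F n) < e)"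
  by (simp add: Cauchy_def dist_absv)

definition null_seq :: "(nat \<Rightarrow> 'a :: nonarch_field) \<Rightarrow> bool"
  where "null_seq F \<longleftrightarrow> (\<lambda>n. absv (F n)) \<longlonglongrightarrow> 0"

lemma null_seq_bound:
  assumes "G \<longlonglongrightarrow> 0" "eventually (\<lambda>n. absv (F n) \<le> G n) sequentially"
  shows "null_seq F"
  unfolding null_seq_def
  by (rule tendsto_sandwich[OF _ assms(2) tendsto_const assms(1)]) auto

lemma null_seq_0 [simp]: "null_seq (\<lambda>_. 0)"
  by (simp add: null_seq_def)

lemma null_seq_const_iff [simp]: "null_seq (\<lambda>_. c) \<longleftrightarrow> c = 0"
  by (simp add: null_seq_def LIMSEQ_const_iff)

lemma null_seq_minus: "null_seq F \<Longrightarrow> null_seq (\<lambda>n. - F n)"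
  by (simp add: null_seq_def)

lemma null_seq_minus_commute: "null_seq (\<lambda>n. F n - G n) \<longleftrightarrow> null_seq (\<lambda>n. G n - F n)"
  by (simp add: null_seq_def absv_minus_commute)

lemma null_seq_add:
  assumes "null_seq F" "null_seq G"
  shows "null_seq (\<lambda>n. F n + G n)"
  using tendsto_add[OF assms[unfolded null_seq_def]]
  by (intro null_seq_bound[where G = "\<lambda>n. absv (F n) + absv (G n)"] always_eventually)
     (auto intro: absv_triangle)

lemma convergent_absv_Cauchy:
  fixes F :: "nat \<Rightarrow> 'a :: nonarch_field"
  assumes "Cauchy F"
  shows "convergent (\<lambda>n. absv (F n))"
proof -
  have "Cauchy (\<lambda>n. absv (F n))"
    unfolding Cauchy_def
  proof (intro allI impI)
    fix e :: real
    assume "e > 0"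
    then obtain M where M: "\<And>m n. m \<ge> M \<Longrightarrow> n \<ge> M \<Longrightarrow> absv (F m - F n) < e"
      using assms unfolding Cauchy_absv_iff by blast
    show "\<exists>M. \<forall>m\<ge>M. \<forall>n\<ge>M. dist (absv (F m)) (absv (F n)) < e"
      using M absv_diff_triangle[of "F _" "F _"] unfolding dist_real_def
      by (meson le_less_trans)
  qed
  thus ?thesis
    by (simp add: Cauchy_convergent_iff)
qed

lemma Cauchy_absv_bounded:
  fixes F :: "nat \<Rightarrow> 'a :: nonarch_field"
  assumes "Cauchy F"
  obtains B where "B > 0" "\<And>n. absv (F n) \<le> B"
proof -
  from convergent_absv_Cauchy[OF assms] have "Bseq (\<lambda>n. absv (F n))"
    by (rule convergent_imp_Bseq)
  thus ?thesis
    using that by (auto simp: Bseq_def)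
qed

lemma null_seq_mult:
  assumes "Cauchy F" "null_seq G"
  shows "null_seq (\<lambda>n. F n * G n)"
proof -
  obtain B where B: "B > 0" "\<And>n. absv (F n) \<le> B"
    using Cauchy_absv_bounded[OF assms(1)] by blast
  show ?thesis
    using tendsto_mult_right_zero[OF assms(2)[unfolded null_seq_def], of B]
    by (intro null_seq_bound[where G = "\<lambda>n. B * absv (G n)"] always_eventually)
       (auto simp: absv_mult B intro!: mult_right_mono)
qed

lemma Cauchy_const_absv [simp]: "Cauchy (\<lambda>_. c :: 'a :: nonarch_field)"
  by (simp add: Cauchy_absv_iff)

lemma Cauchy_bound:
  fixes Z :: "nat \<Rightarrow> 'a :: nonarch_field"
  assumes "Cauchy (F :: nat \<Rightarrow> 'b :: nonarch_field)" "Cauchy (G :: nat \<Rightarrow> 'c :: nonarch_field)" "C > 0"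
  assumes "\<And>m n. m \<ge> N \<Longrightarrow> n \<ge> N \<Longrightarrow>
             absv (Z m - Z n) \<le> C * max (absv (F m - F n)) (absv (G m - G n))"
  shows "Cauchy Z"
  unfolding Cauchy_absv_iff
proof (intro allI impI)
  fix e :: real
  assume "e > 0"
  with \<open>C > 0\<close> have "e / C > 0"
    by simp
  then obtain M1 M2
    where M: "\<And>m n. m \<ge> M1 \<Longrightarrow> n \<ge> M1 \<Longrightarrow> absv (F m - F n) < e / C"
             "\<And>m n. m \<ge> M2 \<Longrightarrow> n \<ge> M2 \<Longrightarrow> absv (G m - G n) < e / C"
    using assms(1,2) unfolding Cauchy_absv_iff by meson
  show "\<exists>M. \<forall>m\<ge>M. \<forall>n\<ge>M. absv (Z m - Z n) < e"
  proof (intro exI allI impI)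
    fix m n
    assume mn: "m \<ge> max N (max M1 M2)" "n \<ge> max N (max M1 M2)"
    have "absv (Z m - Z n) \<le> C * max (absv (F m - F n)) (absv (G m - G n))"
      using mn by (intro assms) auto
    also have "\<dots> < C * (e / C)"
      using mn M \<open>C > 0\<close> by (intro mult_strict_left_mono) auto
    finally show "absv (Z m - Z n) < e"
      using \<open>C > 0\<close> by simp
  qed
qed

lemma Cauchy_add_absv:
  fixes F G :: "nat \<Rightarrow> 'a :: nonarch_field"
  assumes "Cauchy F" "Cauchy G"
  shows "Cauchy (\<lambda>n. F n + G n)"
  by (rule Cauchy_bound[OF assms, of 1 0])
     (use absv_add_le_max in \<open>auto simp: add_diff_add\<close>)

lemma Cauchy_minus_absv:
  fixes F :: "nat \<Rightarrow> 'a :: nonarch_field"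
  assumes "Cauchy F"
  shows "Cauchy (\<lambda>n. - F n)"
  using assms by (simp add: Cauchy_absv_iff absv_minus_commute)

lemma Cauchy_mult_absv:
  fixes F G :: "nat \<Rightarrow> 'a :: nonarch_field"
  assumes "Cauchy F" "Cauchy G"
  shows "Cauchy (\<lambda>n. F n * G n)"
proof -
  obtain B where B: "B > 0" "\<And>n. absv (F n) \<le> B"
    using Cauchy_absv_bounded[OF assms(1)] by blast
  obtain C where C: "C > 0" "\<And>n. absv (G n) \<le> C"
    using Cauchy_absv_bounded[OF assms(2)] by blast
  show ?thesis
  proof (rule Cauchy_bound[OF assms, of "B + C" 0])
    fix m n
    let ?M = "max (absv (F m - F n)) (absv (G m - G n))"
    have "absv (F m * G m - F n * G n) = absv (F m * (G m - G n) + (F m - F n) * G n)"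
      by (simp add: mult_diff_mult)
    also have "\<dots> \<le> absv (F m) * absv (G m - G n) + absv (F m - F n) * absv (G n)"
      by (rule order.trans[OF absv_triangle]) (simp add: absv_mult)
    also have "\<dots> \<le> B * ?M + ?M * C"
      using B C by (intro add_mono mult_mono) (auto simp: le_max_iff_disj)
    finally show "absv (F m * G m - F n * G n) \<le> (B + C) * ?M"
      by (simp add: algebra_simps)
  qed (use B C in auto)
qed

lemma Cauchy_not_null:
  fixes F :: "nat \<Rightarrow> 'a :: nonarch_field"
  assumes "Cauchy F" "\<not>null_seq F"
  obtains b N where "b > 0" "\<And>n. n \<ge> N \<Longrightarrow> absv (F n) > b"
proof -
  obtain L where L: "(\<lambda>n. absv (F n)) \<longlonglongrightarrow> L"
    using convergent_absv_Cauchy[OF assms(1)] by (auto simp: convergent_def)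
  have "L \<ge> 0"
    by (rule LIMSEQ_le_const[OF L]) auto
  moreover have "L \<noteq> 0"
    using assms(2) L by (auto simp: null_seq_def)
  ultimately have "L / 2 > 0" "L / 2 < L"
    by auto
  from order_tendstoD(1)[OF L this(2)] obtain N where "\<And>n. n \<ge> N \<Longrightarrow> absv (F n) > L / 2"
    by (auto simp: eventually_sequentially)
  with \<open>L / 2 > 0\<close> show ?thesis
    using that by blast
qed

lemma absv_inverse_diff:
  fixes x y :: "'a :: nonarch_field"
  assumes "absv x > b" "absv y > b" "b > 0"
  shows "absv (inverse x - inverse y) \<le> inverse (b ^ 2) * absv (x - y)"
proof -
  have nz: "x \<noteq> 0" "y \<noteq> 0"
    using assms by auto
  have "absv (inverse x - inverse y) = inverse (absv x * absv y) * absv (x - y)"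
    using nz by (simp add: inverse_diff_inverse absv_mult absv_inverse)
  also have "\<dots> \<le> inverse (b ^ 2) * absv (x - y)"
    using assms unfolding power2_eq_square
    by (intro mult_right_mono le_imp_inverse_le mult_mono) auto
  finally show ?thesis .
qed

lemma Cauchy_inverse_absv:
  fixes F :: "nat \<Rightarrow> 'a :: nonarch_field"
  assumes "Cauchy F" "\<not>null_seq F"
  shows "Cauchy (\<lambda>n. inverse (F n))"
proof -
  obtain b N where b: "b > 0" "\<And>n. n \<ge> N \<Longrightarrow> absv (F n) > b"
    using Cauchy_not_null[OF assms] by blast
  show ?thesis
    by (rule Cauchy_bound[OF assms(1) assms(1), of "inverse (b ^ 2)" N])
       (use b absv_inverse_diff[of b "F _" "F _"] in auto)
qed

lemma null_seq_inverse_diff: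
  fixes F G :: "nat \<Rightarrow> 'a :: nonarch_field"
  assumes "Cauchy F" "\<not>null_seq F" "Cauchy G" "\<not>null_seq G" "null_seq (\<lambda>n. F n - G n)"
  shows "null_seq (\<lambda>n. inverse (F n) - inverse (G n))"
proof -
  obtain b N where b: "b > 0" "\<And>n. n \<ge> N \<Longrightarrow> absv (F n) > b"
    using Cauchy_not_null[OF assms(1,2)] by blast
  obtain c M where c: "c > 0" "\<And>n. n \<ge> M \<Longrightarrow> absv (G n) > c"
    using Cauchy_not_null[OF assms(3,4)] by blast
  define d where "d = min b c"
  have d: "d > 0" "\<And>n. n \<ge> max M N \<Longrightarrow> absv (F n) > d \<and> absv (G n) > d"
    using b c by (auto simp: d_def min_less_iff_disj)
  show ?thesis
  proof (rule null_seq_bound)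
    show "(\<lambda>n. inverse (d ^ 2) * absv (F n - G n)) \<longlonglongrightarrow> 0"
      using tendsto_mult_right_zero[OF assms(5)[unfolded null_seq_def]] by simp
    show "eventually (\<lambda>n. absv (inverse (F n) - inverse (G n)) \<le>
            inverse (d ^ 2) * absv (F n - G n)) sequentially"
      using eventually_ge_at_top[of "max M N"]
      by eventually_elim (use d absv_inverse_diff in blast)
  qed
qed

section \<open>Completion of a non-Archimedean valued field\<close>

definition completion_rel :: "(nat \<Rightarrow> 'a :: nonarch_field) \<Rightarrow> (nat \<Rightarrow> 'a) \<Rightarrow> bool" where
  "completion_rel F G \<longleftrightarrow> Cauchy F \<and> Cauchy G \<and> (\<lambda>n. dist (F n) (G n)) \<longlonglongrightarrow> 0"

lemma completion_rel_iff:
  "completion_rel F G \<longleftrightarrow> Cauchy F \<and> Cauchy G \<and> null_seq (\<lambda>n. F n - G n)"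
  by (simp add: completion_rel_def null_seq_def dist_absv)

lemma part_equivp_completion_rel:
  "part_equivp (completion_rel :: (nat \<Rightarrow> 'a :: nonarch_field) \<Rightarrow> _)"
proof (rule part_equivpI)
  show "\<exists>F :: nat \<Rightarrow> 'a. completion_rel F F"
    by (rule exI[of _ "\<lambda>_. 0"]) (simp add: completion_rel_iff)
  show "symp (completion_rel :: (nat \<Rightarrow> 'a) \<Rightarrow> _)"
    by (auto simp: symp_def completion_rel_iff intro: null_seq_minus_commute[THEN iffD1])
  show "transp (completion_rel :: (nat \<Rightarrow> 'a) \<Rightarrow> _)"
    unfolding transp_def completion_rel_iff
  proof safe
    fix F G Z :: "nat \<Rightarrow> 'a"
    assume "null_seq (\<lambda>n. F n - G n)" "null_seq (\<lambda>n. G n - Z n)"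
    from null_seq_add[OF this] show "null_seq (\<lambda>n. F n - Z n)"
      by simp
  qed
qed

quotient_type (overloaded) 'a completion = "nat \<Rightarrow> 'a :: nonarch_field" / partial: completion_rel
  by (rule part_equivp_completion_rel)

instantiation completion :: (nonarch_field) field
begin

lift_definition zero_completion :: "'a completion" is "\<lambda>_. 0"
  by (simp add: completion_rel_iff)

lift_definition one_completion :: "'a completion" is "\<lambda>_. 1"
  by (simp add: completion_rel_iff)

lift_definition plus_completion :: "'a completion \<Rightarrow> 'a completion \<Rightarrow> 'a completion"
  is "\<lambda>F G n. F n + G n"
  by (auto simp: completion_rel_iff add_diff_add intro: Cauchy_add_absv null_seq_add)

lift_definition uminus_completion :: "'a completion \<Rightarrow> 'a completion"
  is "\<lambda>F n. - F n"
  by (auto simp: completion_rel_iff intro: Cauchy_minus_absv null_seq_minus_commute[THEN iffD1])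

lift_definition times_completion :: "'a completion \<Rightarrow> 'a completion \<Rightarrow> 'a completion"
  is "\<lambda>F G n. F n * G n"
proof -
  fix F F' G G' :: "nat \<Rightarrow> 'a"
  assume *: "completion_rel F F'" "completion_rel G G'"
  have "null_seq (\<lambda>n. F n * (G n - G' n) + G' n * (F n - F' n))"
    using * by (intro null_seq_add null_seq_mult) (auto simp: completion_rel_iff)
  also have "(\<lambda>n. F n * (G n - G' n) + G' n * (F n - F' n)) = (\<lambda>n. F n * G n - F' n * G' n)"
    by (simp add: algebra_simps)
  finally show "completion_rel (\<lambda>n. F n * G n) (\<lambda>n. F' n * G' n)"
    using * by (auto simp: completion_rel_iff intro: Cauchy_mult_absv)
qed

lift_definition inverse_completion :: "'a completion \<Rightarrow> 'a completion"
  is "\<lambda>F. if null_seq F then (\<lambda>_. 0) else (\<lambda>n. inverse (F n))"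
proof -
  fix F G :: "nat \<Rightarrow> 'a"
  assume *: "completion_rel F G"
  have "null_seq F \<longleftrightarrow> null_seq G"
    using null_seq_add[of G "\<lambda>n. F n - G n"] null_seq_add[of F "\<lambda>n. G n - F n"] *
    by (auto simp: completion_rel_iff null_seq_minus_commute[of F G])
  with * show "completion_rel (if null_seq F then (\<lambda>_. 0) else (\<lambda>n. inverse (F n)))
                 (if null_seq G then (\<lambda>_. 0) else (\<lambda>n. inverse (G n)))"
    by (auto simp: completion_rel_iff intro: Cauchy_inverse_absv null_seq_inverse_diff)
qed

definition minus_completion :: "'a completion \<Rightarrow> 'a completion \<Rightarrow> 'a completion"
  where "minus_completion x y = x + - y"

definition divide_completion :: "'a completion \<Rightarrow> 'a completion \<Rightarrow> 'a completion"
  where "divide_completion x y = x * inverse y"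

instance
proof
  fix a b c :: "'a completion"
  show "a + b = b + a"
    by transfer (auto simp: completion_rel_iff add.commute intro!: Cauchy_add_absv)
  show "(a + b) + c = a + (b + c)"
    by transfer (auto simp: completion_rel_iff add.assoc intro!: Cauchy_add_absv)
  show "0 + a = a"
    by transfer (auto simp: completion_rel_iff)
  show "- a + a = 0"
    by transfer (auto simp: completion_rel_iff)
  show "(a * b) * c = a * (b * c)"
    by transfer (auto simp: completion_rel_iff mult.assoc intro!: Cauchy_mult_absv)
  show "a * b = b * a"
    by transfer (auto simp: completion_rel_iff mult.commute intro!: Cauchy_mult_absv)
  show "1 * a = a"
    by transfer (auto simp: completion_rel_iff)
  show "(a + b) * c = a * c + b * c"
    by transfer (auto simp: completion_rel_iff distrib_right intro!: Cauchy_mult_absv Cauchy_add_absv)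
  show "(0 :: 'a completion) \<noteq> 1"
    by transfer (auto simp: completion_rel_iff)
  show "inverse (0 :: 'a completion) = 0"
    by transfer (auto simp: completion_rel_iff)
  show "inverse a * a = 1" if "a \<noteq> 0"
    using that
  proof transfer
    fix F :: "nat \<Rightarrow> 'a"
    assume *: "completion_rel F F" "\<not>completion_rel F (\<lambda>_. 0)"
    hence F: "Cauchy F" "\<not>null_seq F"
      by (auto simp: completion_rel_iff)
    obtain b N where b: "b > 0" "\<And>n. n \<ge> N \<Longrightarrow> absv (F n) > b"
      using Cauchy_not_null[OF F] by blast
    have "null_seq (\<lambda>n. inverse (F n) * F n - 1)"
    proof (rule null_seq_bound[of "\<lambda>_. 0"])
      show "eventually (\<lambda>n. absv (inverse (F n) * F n - 1) \<le> 0) sequentially"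
        using eventually_ge_at_top[of N]
      proof eventually_elim
        case (elim n)
        with b have "F n \<noteq> 0"
          by fastforce
        thus ?case
          by simp
      qed
    qed auto
    thus "completion_rel (\<lambda>n. (if null_seq F then \<lambda>_. 0 else (\<lambda>n. inverse (F n))) n * F n) (\<lambda>_. 1)"
      using F by (auto simp: completion_rel_iff intro!: Cauchy_mult_absv Cauchy_inverse_absv)
  qed
  show "a - b = a + - b"
    by (fact minus_completion_def)
  show "a div b = a * inverse b"
    by (fact divide_completion_def)
qed

end

lemma tendsto_lim_absv:
  fixes F :: "nat \<Rightarrow> 'a :: nonarch_field"
  shows "Cauchy F \<Longrightarrow> (\<lambda>n. absv (F n)) \<longlonglongrightarrow> lim (\<lambda>n. absv (F n))"
  using convergent_absv_Cauchy convergent_LIMSEQ_iff by blast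

lift_definition absv_completion_aux :: "'a :: nonarch_field completion \<Rightarrow> real"
  is "\<lambda>F. lim (\<lambda>n. absv (F n))"
proof -
  fix F G :: "nat \<Rightarrow> 'a"
  assume *: "completion_rel F G"
  define L where "L = lim (\<lambda>n. absv (F n))"
  have L: "(\<lambda>n. absv (F n)) \<longlonglongrightarrow> L"
    unfolding L_def by (rule tendsto_lim_absv) (use * in \<open>simp add: completion_rel_iff\<close>)
  have "(\<lambda>n. absv (F n - G n)) \<longlonglongrightarrow> 0"
    using * by (simp add: completion_rel_iff null_seq_def)
  hence "(\<lambda>n. absv (F n) - absv (G n)) \<longlonglongrightarrow> 0"
    by (rule tendsto_0_le[where K = 1])
       (auto intro!: always_eventually absv_diff_triangle)
  from tendsto_diff[OF L this] have "(\<lambda>n. absv (G n)) \<longlonglongrightarrow> L"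
    by simp
  thus "lim (\<lambda>n. absv (F n)) = lim (\<lambda>n. absv (G n))"
    unfolding L_def by (rule limI[symmetric])
qed

instantiation completion :: (nonarch_field) nonarch_field
begin

definition absv_completion :: "'a completion \<Rightarrow> real"
  where "absv_completion = absv_completion_aux"

definition dist_completion :: "'a completion \<Rightarrow> 'a completion \<Rightarrow> real"
  where "dist_completion x y = absv (x - y)"

definition uniformity_completion :: "('a completion \<times> 'a completion) filter"
  where "uniformity_completion = (INF e\<in>{0 <..}. principal {(x, y). dist x y < e})"

definition open_completion :: "'a completion set \<Rightarrow> bool"
  where "open_completion U \<longleftrightarrow> (\<forall>x\<in>U. \<forall>\<^sub>F (x', y) in uniformity. x' = x \<longrightarrow> y \<in> U)"

instance
proof
  have ge0: "absv x \<ge> 0" for x :: "'a completion"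
    unfolding absv_completion_def
  proof transfer
    fix F :: "nat \<Rightarrow> 'a"
    assume "completion_rel F F"
    thus "0 \<le> lim (\<lambda>n. absv (F n))"
      by (intro LIMSEQ_le_const[OF tendsto_lim_absv]) (auto simp: completion_rel_iff)
  qed
  have eq0: "absv x = 0 \<longleftrightarrow> x = 0" for x :: "'a completion"
    unfolding absv_completion_def
  proof transfer
    fix F :: "nat \<Rightarrow> 'a"
    assume "completion_rel F F"
    hence "Cauchy F"
      by (simp add: completion_rel_iff)
    moreover from tendsto_lim_absv[OF this] have "lim (\<lambda>n. absv (F n)) = 0 \<longleftrightarrow> null_seq F"
      unfolding null_seq_def by (metis limI)
    ultimately show "lim (\<lambda>n. absv (F n)) = 0 \<longleftrightarrow> completion_rel F (\<lambda>_. 0)"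
      by (simp add: completion_rel_iff)
  qed
  have mult: "absv (x * y) = absv x * absv y" for x y :: "'a completion"
    unfolding absv_completion_def
  proof transfer
    fix F G :: "nat \<Rightarrow> 'a"
    assume "completion_rel F F" "completion_rel G G"
    hence "Cauchy F" "Cauchy G"
      by (simp_all add: completion_rel_iff)
    from tendsto_mult[OF this[THEN tendsto_lim_absv]]
      show "lim (\<lambda>n. absv (F n * G n)) = lim (\<lambda>n. absv (F n)) * lim (\<lambda>n. absv (G n))"
      unfolding absv_mult by (rule limI)
  qed
  have add: "absv (x + y) \<le> max (absv x) (absv y)" for x y :: "'a completion"
    unfolding absv_completion_def
  proof transfer
    fix F G :: "nat \<Rightarrow> 'a"
    assume "completion_rel F F" "completion_rel G G"
    hence *: "Cauchy F" "Cauchy G"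
      by (simp_all add: completion_rel_iff)
    show "lim (\<lambda>n. absv (F n + G n)) \<le> max (lim (\<lambda>n. absv (F n))) (lim (\<lambda>n. absv (G n)))"
      by (rule LIMSEQ_le[OF tendsto_lim_absv[OF Cauchy_add_absv[OF *]]
            tendsto_max[OF *[THEN tendsto_lim_absv]]])
         (auto intro: absv_add_le_max)
  qed
  fix x y z :: "'a completion"
  show "absv x \<ge> 0" "absv x = 0 \<longleftrightarrow> x = 0" "absv (x * y) = absv x * absv y"
       "absv (x + y) \<le> max (absv x) (absv y)"
    by (rule ge0 eq0 mult add)+
  show "dist x y = absv (x - y)"
    by (simp add: dist_completion_def)
  show "dist x y = 0 \<longleftrightarrow> x = y"
    by (simp add: dist_completion_def eq0)
  show "dist x y \<le> dist x z + dist y z"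
    unfolding dist_completion_def by (rule ultrametric_imp_triangle2) (rule ge0 eq0 mult add)+
qed (fact uniformity_completion_def open_completion_def)+

end

lift_definition to_completion :: "'a :: nonarch_field \<Rightarrow> 'a completion" is "\<lambda>x _. x"
  by (simp add: completion_rel_iff)

lemma to_completion_0 [simp]: "to_completion 0 = 0"
  by transfer (simp add: completion_rel_iff)

lemma to_completion_1 [simp]: "to_completion 1 = 1"
  by transfer (simp add: completion_rel_iff)

lemma to_completion_add [simp]: "to_completion (x + y) = to_completion x + to_completion y"
  by transfer (simp add: completion_rel_iff)

lemma to_completion_minus [simp]: "to_completion (- x) = - to_completion x"
  by transfer (simp add: completion_rel_iff)

lemma to_completion_diff [simp]: "to_completion (x - y) = to_completion x - to_completion y"
  using to_completion_add[of x "- y"] by simp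

lemma to_completion_mult [simp]: "to_completion (x * y) = to_completion x * to_completion y"
  by transfer (simp add: completion_rel_iff)

lemma absv_to_completion [simp]: "absv (to_completion x) = absv x"
  unfolding absv_completion_def by transfer (simp add: limI)

lemma to_completion_of_nat [simp]: "to_completion (of_nat n) = of_nat n"
  by (induction n) auto

lemma to_completion_eq_iff [simp]: "to_completion x = to_completion y \<longleftrightarrow> x = y"
  by (metis absv_eq_0_iff absv_to_completion right_minus_eq to_completion_diff)

instance completion :: ("{nonarch_field, field_char_0}") field_char_0
proof
  show "inj (of_nat :: nat \<Rightarrow> 'a completion)"
    by (rule injI) (metis of_nat_eq_iff to_completion_eq_iff to_completion_of_nat)
qed

lemma to_completion_tendsto:
  fixes F :: "nat \<Rightarrow> 'a :: nonarch_field"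
  assumes "Cauchy F"
  shows "(\<lambda>n. to_completion (F n)) \<longlonglongrightarrow> abs_completion F"
  unfolding lim_sequentially
proof (intro allI impI)
  fix e :: real
  assume "e > 0"
  then obtain M where M: "\<And>m n. m \<ge> M \<Longrightarrow> n \<ge> M \<Longrightarrow> absv (F m - F n) < e / 2"
    using assms unfolding Cauchy_absv_iff by (meson half_gt_zero)
  show "\<exists>M. \<forall>m\<ge>M. dist (to_completion (F m)) (abs_completion F) < e"
  proof (intro exI allI impI)
    fix m
    assume m: "m \<ge> M"
    have C: "Cauchy (\<lambda>n. F m + - F n)"
      by (intro Cauchy_add_absv Cauchy_minus_absv assms) auto
    have "to_completion (F m) - abs_completion F = abs_completion (\<lambda>n. F m + - F n)"
      using assms unfolding minus_completion_def
      by (simp add: to_completion.abs_eq uminus_completion.abs_eq plus_completion.abs_eq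
            completion_rel_iff Cauchy_minus_absv)
    hence "dist (to_completion (F m)) (abs_completion F) = lim (\<lambda>n. absv (F m + - F n))"
      using C by (simp add: dist_absv absv_completion_def absv_completion_aux.abs_eq completion_rel_iff)
    also have "\<dots> \<le> e / 2"
      by (rule LIMSEQ_le_const2[OF tendsto_lim_absv[OF C]])
         (use M m in \<open>auto intro!: exI[of _ M] less_imp_le\<close>)
    also have "\<dots> < e"
      using \<open>e > 0\<close> by simp
    finally show "dist (to_completion (F m)) (abs_completion F) < e" .
  qed
qed

lemma to_completion_dense:
  fixes x :: "'a :: nonarch_field completion"
  assumes "e > 0"
  obtains y where "dist (to_completion y) x < e"
proof -
  obtain F where F: "completion_rel F F" "x = abs_completion F"
    by (induction x) auto
  have "(\<lambda>n. to_completion (F n)) \<longlonglongrightarrow> x"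
    using F to_completion_tendsto by (auto simp: completion_rel_iff)
  from tendstoD[OF this assms] show ?thesis
    using that by (auto simp: eventually_sequentially)
qed

instance completion :: (nonarch_field) complete_space
proof
  fix G :: "nat \<Rightarrow> 'a completion"
  assume G: "Cauchy G"
  have "\<exists>x. dist (to_completion x) (G n) < 1 / real (Suc n)" for n
    by (rule to_completion_dense[of "1 / real (Suc n)" "G n"]) auto
  then obtain x where x: "\<And>n. dist (to_completion (x n)) (G n) < 1 / real (Suc n)"
    by metis
  have lim0: "(\<lambda>n. dist (to_completion (x n)) (G n)) \<longlonglongrightarrow> 0"
    by (rule tendsto_sandwich[OF _ _ tendsto_const LIMSEQ_inverse_real_of_nat])
       (use x in \<open>auto intro!: always_eventually less_imp_le simp: inverse_eq_divide\<close>)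
  have "Cauchy x"
    unfolding Cauchy_def
  proof (intro allI impI)
    fix e :: real
    assume e: "e > 0"
    obtain M where M: "\<And>m n. m \<ge> M \<Longrightarrow> n \<ge> M \<Longrightarrow> dist (G m) (G n) < e / 3"
      using G e unfolding Cauchy_def by (meson divide_pos_pos zero_less_numeral)
    have "eventually (\<lambda>n. dist (to_completion (x n)) (G n) < e / 3) sequentially"
      by (rule order_tendstoD(2)[OF lim0]) (use e in auto)
    then obtain N where N: "\<And>n. n \<ge> N \<Longrightarrow> dist (to_completion (x n)) (G n) < e / 3"
      by (auto simp: eventually_sequentially)
    show "\<exists>M. \<forall>m\<ge>M. \<forall>n\<ge>M. dist (x m) (x n) < e"
    proof (intro exI allI impI)
      fix m n
      assume mn: "m \<ge> max M N" "n \<ge> max M N"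
      have "dist (x m) (x n) = dist (to_completion (x m)) (to_completion (x n))"
        by (simp add: dist_absv flip: to_completion_diff)
      also have "\<dots> \<le> dist (to_completion (x m)) (G m) + dist (G m) (G n) +
                       dist (to_completion (x n)) (G n)"
        using dist_triangle[of "to_completion (x m)" "to_completion (x n)" "G m"]
              dist_triangle2[of "G m" "to_completion (x n)" "G n"]
        by linarith
      also have "\<dots> < e"
        using M[of m n] N[of m] N[of n] mn by simp
      finally show "dist (x m) (x n) < e" .
    qed
  qed
  from to_completion_tendsto[OF this] lim0 have "G \<longlonglongrightarrow> abs_completion x"
    by - (subst tendsto_dist_iff, rule tendsto_sandwich[OF _ _ tendsto_const
            tendsto_add_zero[OF _ iffD1[OF tendsto_dist_iff]]],
          auto intro!: always_eventually dist_triangle3)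
  thus "convergent G"
    by (auto simp: convergent_def)
qed

section \<open>Extending the absolute value to the algebraic closure\<close>

text \<open>
  Chevalley's argument: a subring of the algebraic closure that is maximal among those meeting the
  base field exactly in its valuation ring is itself a valuation ring. Since the extension is
  algebraic, every non-zero \<open>x\<close> has a power \<open>x ^ n\<close> that agrees, up to a unit of this ring, with an
  element \<open>c\<close> of the base field, and \<open>root n (absv c)\<close> is the required absolute value of \<open>x\<close>.
\<close>

locale lies_over =
  fixes R :: "'a :: nonarch_field alg_closure set"
  assumes base_in: "absv a \<le> 1 \<Longrightarrow> to_ac a \<in> R"
    and base_le: "to_ac a \<in> R \<Longrightarrow> absv a \<le> 1"
    and add_in: "x \<in> R \<Longrightarrow> y \<in> R \<Longrightarrow> x + y \<in> R"
    and mult_in: "x \<in> R \<Longrightarrow> y \<in> R \<Longrightarrow> x * y \<in> R"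
begin

lemma zero_in: "0 \<in> R" and one_in: "1 \<in> R"
  using base_in[of 0] base_in[of 1] by simp_all

lemma minus_in: "x \<in> R \<Longrightarrow> - x \<in> R"
  using mult_in[of "to_ac (-1)" x] base_in[of "-1"] by simp

lemma diff_in: "x \<in> R \<Longrightarrow> y \<in> R \<Longrightarrow> x - y \<in> R"
  using add_in[of x "- y"] minus_in[of y] by simp

lemma power_in: "x \<in> R \<Longrightarrow> x ^ n \<in> R"
  by (induction n) (auto intro: one_in mult_in)

lemma sum_in: "(\<And>i. i \<in> A \<Longrightarrow> f i \<in> R) \<Longrightarrow> sum f A \<in> R"
  by (induction A rule: infinite_finite_induct) (auto intro: zero_in add_in)

definition mI :: "'a alg_closure set" where
  "mI = {to_ac c * r |c r. absv c < 1 \<and> r \<in> R}"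

lemma mI_I: "absv c < 1 \<Longrightarrow> r \<in> R \<Longrightarrow> to_ac c * r \<in> mI"
  by (auto simp: mI_def)

lemma mI_subset: "x \<in> mI \<Longrightarrow> x \<in> R"
  by (auto simp: mI_def intro!: mult_in base_in)

lemma mI_zero: "0 \<in> mI"
  using mI_I[of 0 0] zero_in by simp

lemma mI_mult:
  assumes "x \<in> mI" "y \<in> R"
  shows "x * y \<in> mI"
proof -
  obtain c r where "x = to_ac c * r" "absv c < 1" "r \<in> R"
    using assms by (auto simp: mI_def)
  thus ?thesis
    using mI_I[of c "r * y"] assms mult_in by (simp add: mult.assoc)
qed

lemma mI_add_aux:
  assumes "absv c \<le> absv d" "absv d < 1" "r \<in> R" "s \<in> R"
  shows "to_ac c * r + to_ac d * s \<in> mI"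
proof (cases "d = 0")
  case True
  with assms have "c = 0"
    by (metis absv_0 absv_eq_0_iff absv_ge_0 order.antisym)
  with True show ?thesis
    by (simp add: mI_zero)
next
  case False
  have eq: "to_ac c * r + to_ac d * s = to_ac d * (to_ac (c / d) * r + s)"
    using False by (simp add: distrib_left)
  have le: "absv (c / d) \<le> 1"
    using assms False by (simp add: absv_divide)
  show ?thesis
    unfolding eq by (intro mI_I add_in mult_in base_in le assms)
qed

lemma mI_add:
  assumes "x \<in> mI" "y \<in> mI"
  shows "x + y \<in> mI"
proof -
  obtain c r where x: "x = to_ac c * r" "absv c < 1" "r \<in> R"
    using assms by (auto simp: mI_def)
  obtain d s where y: "y = to_ac d * s" "absv d < 1" "s \<in> R"
    using assms by (auto simp: mI_def)
  show ?thesis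
  proof (cases "absv c \<le> absv d")
    case True
    thus ?thesis
      using mI_add_aux[of c d r s] x y by auto
  next
    case False
    thus ?thesis
      using mI_add_aux[of d c s r] x y by (auto simp: add.commute)
  qed
qed

lemma mI_minus: "x \<in> mI \<Longrightarrow> - x \<in> mI"
  using mI_mult[of x "-1"] minus_in[OF one_in] by simp

lemma mI_diff: "x \<in> mI \<Longrightarrow> y \<in> mI \<Longrightarrow> x - y \<in> mI"
  using mI_add[of x "- y"] mI_minus[of y] by simp

lemma one_notin_mI: "1 \<notin> mI"
proof
  assume "1 \<in> mI"
  then obtain c r where *: "1 = to_ac c * r" "absv c < 1" "r \<in> R"
    by (auto simp: mI_def)
  hence "c \<noteq> 0"
    by auto
  with * have "r = to_ac (inverse c)"
    by (simp add: field_simps)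
  with * have "absv (inverse c) \<le> 1"
    using base_le by auto
  moreover have "absv c > 0"
    using \<open>c \<noteq> 0\<close> by (simp add: order.not_eq_order_implies_strict)
  ultimately show False
    using * by (auto simp: absv_inverse inverse_le_1_iff)
qed

end

locale maximal_lies_over = lies_over +
  assumes maximal: "\<And>S. lies_over S \<Longrightarrow> R \<subseteq> S \<Longrightarrow> S = R"
begin

lemma one_minus_mI_unit:
  assumes b: "b \<in> mI"
  shows "inverse (1 - b) \<in> R"
proof -
  define S where "S = {x / (1 - b) |x b. x \<in> R \<and> b \<in> mI}"
  have nz: "1 - b \<noteq> 0" if "b \<in> mI" for b
    using that one_notin_mI by auto
  have sub: "R \<subseteq> S"
  proof
    fix x assume "x \<in> R"
    moreover have "x = x / (1 - 0)"
      by simp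
    ultimately show "x \<in> S"
      unfolding S_def using mI_zero by blast
  qed
  have "lies_over S"
  proof
    fix x :: 'a
    show "to_ac x \<in> S" if "absv x \<le> 1"
      using sub base_in[OF that] by blast
    show "absv x \<le> 1" if x_in: "to_ac x \<in> S"
    proof (rule ccontr)
      assume "\<not>absv x \<le> 1"
      hence x: "absv x > 1" "x \<noteq> 0"
        by auto
      obtain y b where yb: "to_ac x = y / (1 - b)" "y \<in> R" "b \<in> mI"
        using x_in by (auto simp: S_def)
      hence "1 - b = to_ac (inverse x) * y"
        using x nz[of b] by (simp add: field_simps)
      moreover have "absv (inverse x) < 1"
        using x by (simp add: absv_inverse inverse_less_1_iff)
      ultimately have "1 - b \<in> mI"
        using yb mI_I[of "inverse x" y] by simp
      from mI_add[OF this \<open>b \<in> mI\<close>] show False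
        using one_notin_mI by simp
    qed
  next
    fix u w assume "u \<in> S" "w \<in> S"
    then obtain x b y c where u: "u = x / (1 - b)" "x \<in> R" "b \<in> mI"
      and w: "w = y / (1 - c)" "y \<in> R" "c \<in> mI"
      by (auto simp: S_def)
    define d where "d = b + c - b * c"
    have d: "d \<in> mI" "(1 - b) * (1 - c) = 1 - d"
      unfolding d_def using u w mI_subset[of c]
      by (auto intro!: mI_add mI_diff mI_mult simp: algebra_simps)
    have "u * w = (x * y) / (1 - d)"
      by (simp add: u(1) w(1) flip: d(2))
    thus "u * w \<in> S"
      unfolding S_def using u w d by (auto intro!: mult_in)
    have "u + w = (x * (1 - c) + y * (1 - b)) / (1 - d)"
      unfolding u(1) w(1) d(2)[symmetric] using nz[of b] nz[of c] u w by (intro add_frac_eq) auto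
    moreover have "x * (1 - c) + y * (1 - b) \<in> R"
      using u w mI_subset by (auto intro!: add_in mult_in diff_in one_in)
    ultimately show "u + w \<in> S"
      unfolding S_def using d by blast
  qed
  from maximal[OF this sub] have "S = R" .
  moreover have "inverse (1 - b) \<in> S"
    unfolding S_def inverse_eq_divide using b one_in by blast
  ultimately show ?thesis
    by simp
qed

lemma adjoin:
  assumes "x \<notin> R"
  obtains q where "\<And>i. coeff q i \<in> mI" "poly q x = 1"
proof -
  define S where "S = {poly q x |q. \<forall>i. coeff q i \<in> R}"
  have sub: "R \<subseteq> S"
  proof
    fix y assume "y \<in> R"
    hence "\<forall>i. coeff [:y:] i \<in> R" "y = poly [:y:] x"
      by (auto simp: coeff_pCons zero_in split: nat.splits)
    thus "y \<in> S"
      unfolding S_def by blast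
  qed
  have "\<forall>i. coeff [:0, 1:] i \<in> R" "x = poly [:0, 1:] x"
    by (auto simp: coeff_pCons zero_in one_in split: nat.splits)
  hence "x \<in> S"
    unfolding S_def by blast
  with assms have "S \<noteq> R"
    by blast
  hence "\<not>lies_over S"
    using maximal[of S] sub by blast
  have "\<exists>a. to_ac a \<in> S \<and> absv a > 1"
  proof (rule ccontr)
    assume *: "\<not>(\<exists>a. to_ac a \<in> S \<and> absv a > 1)"
    have "lies_over S"
    proof
      fix u w assume "u \<in> S" "w \<in> S"
      then obtain p q where pq: "u = poly p x" "w = poly q x" "\<forall>i. coeff p i \<in> R" "\<forall>i. coeff q i \<in> R"
        by (auto simp: S_def)
      have "u + w = poly (p + q) x" "u * w = poly (p * q) x" "\<forall>i. coeff (p + q) i \<in> R" "\<forall>i. coeff (p * q) i \<in> R"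
        using pq by (auto intro!: add_in mult_in sum_in simp: coeff_mult)
      thus "u + w \<in> S" "u * w \<in> S"
        unfolding S_def by blast+
    qed (use * sub base_in in \<open>force+\<close>)
    with \<open>\<not>lies_over S\<close> show False
      by contradiction
  qed
  then obtain a q where a: "absv a > 1" "to_ac a = poly q x" "\<forall>i. coeff q i \<in> R"
    by (auto simp: S_def)
  define q' where "q' = smult (to_ac (inverse a)) q"
  have "a \<noteq> 0"
    using a by auto
  have "absv (inverse a) < 1"
    using a \<open>a \<noteq> 0\<close> by (simp add: absv_inverse inverse_less_1_iff)
  hence "coeff q' i \<in> mI" for i
    using a mI_I[of "inverse a" "coeff q i"] by (simp add: q'_def)
  moreover have "poly q' x = 1"
    using \<open>a \<noteq> 0\<close> by (simp add: q'_def flip: a(2))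
  ultimately show ?thesis
    using that by blast
qed

lemma reduce_degree:
  assumes "x \<noteq> 0"
    and q: "\<And>i. coeff q i \<in> mI" "poly q x = 1"
    and r: "\<And>i. coeff r i \<in> mI" "poly r (inverse x) = 1"
    and deg: "degree r \<le> degree q"
  shows "\<exists>s. (\<forall>i. coeff s i \<in> mI) \<and> poly s x = 1 \<and> degree s < degree q"
proof -
  define n where "n = degree q"
  define k where "k = degree r"
  have "k > 0"
  proof (rule ccontr)
    assume "\<not>k > 0"
    then obtain c where "r = [:c:]"
      by (auto simp: k_def elim!: degree_eq_zeroE)
    with r have "1 \<in> mI"
      using r(1)[of 0] by simp
    thus False
      using one_notin_mI by contradiction
  qed
  define u where "u = inverse (1 - coeff r 0)"
  have u: "u \<in> R" "u * (1 - coeff r 0) = 1"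
    using one_minus_mI_unit[OF r(1)[of 0]] r(1)[of 0] one_notin_mI
    by (auto simp: u_def intro!: left_inverse)
  define h where "h = (\<Sum>j\<in>{1..k}. monom (coeff r j * u) (k - j))"
  have h_coeff: "coeff h i \<in> mI" for i
  proof -
    have "(\<Sum>j\<in>A. coeff (monom (coeff r j * u) (k - j)) i) \<in> mI" for A
      by (induction A rule: infinite_finite_induct) (auto intro!: mI_zero mI_add mI_mult r u)
    thus ?thesis
      by (simp add: h_def coeff_sum)
  qed
  have h_deg: "degree h < k"
  proof -
    have "degree h \<le> k - 1"
      unfolding h_def
      by (intro degree_sum_le) (auto intro!: order.trans[OF degree_monom_le])
    with \<open>k > 0\<close> show ?thesis
      by simp
  qed
  have "1 = (\<Sum>j\<le>k. coeff r j * inverse x ^ j)"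
    using r(2) by (simp add: poly_altdef k_def)
  also have "{..k} = insert 0 {1..k}"
    by auto
  finally have "1 - coeff r 0 = (\<Sum>j\<in>{1..k}. coeff r j * inverse x ^ j)"
    by (simp add: algebra_simps)
  hence "x ^ k * (u * (1 - coeff r 0)) = x ^ k * (u * (\<Sum>j\<in>{1..k}. coeff r j * inverse x ^ j))"
    by simp
  also have "\<dots> = (\<Sum>j\<in>{1..k}. coeff r j * u * x ^ (k - j))"
    unfolding sum_distrib_left
    by (rule sum.cong) (use \<open>x \<noteq> 0\<close> in \<open>auto simp: power_diff field_simps\<close>)
  also have "\<dots> = poly h x"
    by (simp add: h_def poly_sum poly_monom)
  finally have h: "poly h x = x ^ k"
    by (simp add: u)
  define a where "a = lead_coeff q"
  define s where "s = (q - monom a n) + monom a (n - k) * h"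
  have "coeff s i \<in> mI" for i
  proof -
    have "coeff (monom a (n - k) * h) i \<in> mI"
      using h_coeff mI_mult[OF h_coeff mI_subset[OF q(1)]] mI_zero
      by (auto simp: coeff_monom_mult a_def mult.commute[of "lead_coeff q"])
    moreover have "coeff (q - monom a n) i \<in> mI"
      using q(1)[of i] mI_zero by (auto simp: a_def n_def)
    ultimately show ?thesis
      by (auto simp: s_def intro!: mI_add)
  qed
  moreover have "poly s x = 1"
  proof -
    have "poly s x = poly q x - a * x ^ n + a * (x ^ (n - k) * x ^ k)"
      by (simp add: s_def poly_monom h)
    also have "x ^ (n - k) * x ^ k = x ^ n"
      using deg by (simp add: n_def k_def flip: power_add)
    finally show ?thesis
      using q by simp
  qed
  moreover have "degree s < n"
  proof -
    have n: "n > 0"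
      using \<open>k > 0\<close> deg by (simp add: n_def k_def)
    have "coeff s i = 0" if "i \<ge> n" for i
    proof -
      have "coeff (q - monom a n) i = 0"
        using that by (auto simp: a_def n_def coeff_eq_0)
      moreover have "coeff (monom a (n - k) * h) i = 0"
      proof -
        have "i - (n - k) > degree h"
          using that h_deg deg by (simp add: n_def k_def)
        thus ?thesis
          by (auto simp: coeff_monom_mult coeff_eq_0)
      qed
      ultimately show ?thesis
        by (simp add: s_def)
    qed
    hence "degree s \<le> n - 1"
      by (intro degree_le) (use n in auto)
    with n show ?thesis
      by simp
  qed
  ultimately show ?thesis
    unfolding n_def by blast
qed

lemma in_or_inverse_in: "x \<in> R \<or> inverse x \<in> R"
proof (rule ccontr)
  assume *: "\<not>(x \<in> R \<or> inverse x \<in> R)"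
  hence "x \<noteq> 0"
    using zero_in by auto
  define P where "P = (\<lambda>y n. \<exists>q. (\<forall>i. coeff q i \<in> mI) \<and> poly q y = 1 \<and> degree q = n)"
  have ex: "\<exists>n. P y n" if "y \<notin> R" for y
    using adjoin[OF that] unfolding P_def by metis
  have min: "\<exists>q. (\<forall>i. coeff q i \<in> mI) \<and> poly q y = 1 \<and> degree q = (LEAST n. P y n)" if "y \<notin> R" for y
    using LeastI_ex[OF ex[OF that]] unfolding P_def by blast
  obtain q where q: "\<And>i. coeff q i \<in> mI" "poly q x = 1" "degree q = (LEAST n. P x n)"
    using min[of x] * by blast
  obtain r where r: "\<And>i. coeff r i \<in> mI" "poly r (inverse x) = 1" "degree r = (LEAST n. P (inverse x) n)"
    using min[of "inverse x"] * by blast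
  show False
  proof (cases "degree r \<le> degree q")
    case True
    then obtain s where "\<forall>i. coeff s i \<in> mI" "poly s x = 1" "degree s < degree q"
      using reduce_degree[of x q r] q r \<open>x \<noteq> 0\<close> by blast
    thus False
      using not_less_Least[of "degree s" "P x"] q(3) by (auto simp: P_def)
  next
    case False
    then obtain s where "\<forall>i. coeff s i \<in> mI" "poly s (inverse x) = 1" "degree s < degree r"
      using reduce_degree[of "inverse x" r q] q r \<open>x \<noteq> 0\<close> by auto
    thus False
      using not_less_Least[of "degree s" "P (inverse x)"] r(3) by (auto simp: P_def)
  qed
qed

definition unit :: "'a alg_closure \<Rightarrow> bool" where
  "unit u \<longleftrightarrow> u \<noteq> 0 \<and> u \<in> R \<and> inverse u \<in> R"

lemma unit_mult: "unit u \<Longrightarrow> unit w \<Longrightarrow> unit (u * w)"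
  by (auto simp: unit_def intro: mult_in)

lemma unit_power: "unit u \<Longrightarrow> unit (u ^ n)"
  by (auto simp: unit_def power_in simp flip: power_inverse)

lemma unit_inverse: "unit u \<Longrightarrow> unit (inverse u)"
  by (auto simp: unit_def)

lemma unit_divide: "unit u \<Longrightarrow> unit w \<Longrightarrow> unit (u / w)"
  unfolding divide_inverse by (intro unit_mult unit_inverse)

lemma unit_to_ac: "unit (to_ac c) \<longleftrightarrow> absv c = 1"
proof
  assume *: "unit (to_ac c)"
  hence "absv c \<le> 1" "inverse (absv c) \<le> 1" "c \<noteq> 0"
    using base_le[of c] base_le[of "inverse c"] by (auto simp: unit_def absv_inverse)
  moreover from this have "absv c > 0"
    by (simp add: order.not_eq_order_implies_strict)
  ultimately show "absv c = 1"
    by (auto simp: inverse_le_1_iff)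
next
  assume *: "absv c = 1"
  hence "c \<noteq> 0"
    by auto
  thus "unit (to_ac c)"
    using base_in[of c] base_in[of "inverse c"] * by (auto simp: unit_def absv_inverse)
qed

lemma nonunit_add:
  assumes "x \<in> R" "\<not>unit x" "y \<in> R" "\<not>unit y"
  shows "\<not>unit (x + y)"
proof
  assume *: "unit (x + y)"
  have aux: False if "w \<noteq> 0" "w \<in> R" "\<not>unit w" "u / w \<in> R" "unit (u + w)" for u w
  proof -
    have "inverse w = (1 + u / w) * inverse (u + w)"
      using that by (simp add: field_simps unit_def)
    hence "inverse w \<in> R"
      using that by (auto intro!: mult_in add_in one_in simp: unit_def)
    with that show False
      by (auto simp: unit_def)
  qed
  have "x \<noteq> 0" "y \<noteq> 0"
    using assms * by auto
  with in_or_inverse_in[of "x / y"] aux[of y x] aux[of x y] assms * show False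
    by (auto simp: add.commute)
qed

lemma nonunit_sum:
  assumes "\<And>i. i \<in> A \<Longrightarrow> f i \<in> R \<and> \<not>unit (f i)"
  shows "sum f A \<in> R \<and> \<not>unit (sum f A)"
  using assms
proof (induction A rule: infinite_finite_induct)
  case (insert i A)
  thus ?case
    using nonunit_add[of "f i" "sum f A"] by (auto intro: add_in)
qed (auto simp: unit_def zero_in)

lemma exists_largest:
  assumes "finite T" "T \<noteq> {}" "\<And>i. i \<in> T \<Longrightarrow> t i \<noteq> 0"
  shows "\<exists>i\<in>T. \<forall>j\<in>T. t j / t i \<in> R"
  using assms
proof (induction rule: finite_ne_induct)
  case (singleton i)
  thus ?case
    by (auto simp: one_in)
next
  case (insert i T)
  then obtain k where k: "k \<in> T" "\<And>j. j \<in> T \<Longrightarrow> t j / t k \<in> R"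
    by auto
  show ?case
  proof (cases "t i / t k \<in> R")
    case True
    with k show ?thesis
      by auto
  next
    case False
    hence ki: "t k / t i \<in> R"
      using in_or_inverse_in[of "t i / t k"] by auto
    have "t j / t i \<in> R" if "j \<in> T" for j
    proof -
      have "t j / t i = (t j / t k) * (t k / t i)"
        using insert.prems[of k] k by simp
      also have "\<dots> \<in> R"
        using k(2)[OF that] ki by (rule mult_in)
      finally show ?thesis .
    qed
    moreover have "t i / t i \<in> R"
      using insert.prems[of i] by (simp add: one_in)
    ultimately show ?thesis
      by auto
  qed
qed

lemma exists_value:
  assumes "x \<noteq> 0"
  obtains n c where "n > 0" "c \<noteq> 0" "unit (x ^ n / to_ac c)"
proof -
  obtain p :: "'a poly" where p: "p \<noteq> 0" "poly (map_poly to_ac p) x = 0"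
    using alg_closure_algebraic[of x] by blast
  define t where "t = (\<lambda>i. to_ac (coeff p i) * x ^ i)"
  define T where "T = {i. i \<le> degree p \<and> coeff p i \<noteq> 0}"
  have T: "finite T" "degree p \<in> T"
    using p by (auto simp: T_def)
  have tnz: "t i \<noteq> 0" if "i \<in> T" for i
    using that assms by (auto simp: t_def T_def)
  have "(\<Sum>i\<le>degree p. t i) = 0"
    using p(2) by (simp add: poly_altdef t_def coeff_map_poly degree_map_poly)
  also have "(\<Sum>i\<le>degree p. t i) = sum t T"
    by (rule sum.mono_neutral_right) (auto simp: T_def t_def)
  finally have sum0: "sum t T = 0" .
  obtain i where i: "i \<in> T" "\<And>j. j \<in> T \<Longrightarrow> t j / t i \<in> R"
    using exists_largest[of T t] T tnz by blast
  have "\<exists>j\<in>T - {i}. unit (t j / t i)"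
  proof (rule ccontr)
    assume *: "\<not>(\<exists>j\<in>T - {i}. unit (t j / t i))"
    have "\<not>unit (\<Sum>j\<in>T-{i}. t j / t i)"
      using nonunit_sum[of "T - {i}" "\<lambda>j. t j / t i"] * i by blast
    also have "(\<Sum>j\<in>T-{i}. t j / t i) = (sum t T - t i) / t i"
      using T i by (simp add: sum_diff1 flip: sum_divide_distrib)
    also have "\<dots> = to_ac (-1)"
      using sum0 tnz[of i] i by simp
    finally show False
      by (simp add: unit_to_ac del: to_ac_minus)
  qed
  then obtain j where j: "j \<in> T" "j \<noteq> i" "unit (t j / t i)"
    by blast
  hence j': "unit (t i / t j)"
    using unit_inverse[OF j(3)] by simp
  note thesisI = that
  have wlog: thesis if ab: "a \<in> T" "b \<in> T" "a < b" "unit (t b / t a)" for a b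
  proof (rule thesisI[of "b - a" "coeff p a / coeff p b"])
    show "b - a > 0" "coeff p a / coeff p b \<noteq> 0"
      using ab by (auto simp: T_def)
    have "t b / t a = x ^ (b - a) / to_ac (coeff p a / coeff p b)"
      using ab assms by (simp add: t_def power_diff T_def mult.commute)
    with ab show "unit (x ^ (b - a) / to_ac (coeff p a / coeff p b))"
      by simp
  qed
  show thesis
    using wlog[of i j] wlog[of j i] i j j' by (cases rule: linorder_cases[of i j]) auto
qed

definition val :: "'a alg_closure \<Rightarrow> real" where
  "val x = (if x = 0 then 0 else SOME r. \<exists>n c. n > 0 \<and> c \<noteq> 0 \<and> unit (x ^ n / to_ac c) \<and> r = root n (absv c))"

lemma val_unique:
  assumes "n > 0" "c \<noteq> 0" "unit (x ^ n / to_ac c)" "m > 0" "d \<noteq> 0" "unit (x ^ m / to_ac d)"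
  shows "root n (absv c) = root m (absv d)"
proof -
  have "x \<noteq> 0"
    using assms by (auto simp: unit_def)
  have "unit ((x ^ m / to_ac d) ^ n / (x ^ n / to_ac c) ^ m)"
    using assms by (intro unit_divide[OF unit_power unit_power])
  also have "(x ^ m / to_ac d) ^ n / (x ^ n / to_ac c) ^ m = to_ac (c ^ m / d ^ n)"
    using assms \<open>x \<noteq> 0\<close> by (simp add: power_divide mult.commute flip: power_mult)
  finally have eq: "absv c ^ m = absv d ^ n"
    using \<open>d \<noteq> 0\<close> unfolding unit_to_ac by (simp add: absv_divide absv_power)
  have "root n (absv c) ^ (n * m) = absv c ^ m" "root m (absv d) ^ (n * m) = absv d ^ n"
    using assms by (simp_all add: power_mult) (metis absv_ge_0 mult.commute power_mult real_root_pow_pos2)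
  with eq have "root n (absv c) ^ (n * m) = root m (absv d) ^ (n * m)"
    by simp
  thus ?thesis
    using assms by (subst (asm) power_eq_iff_eq_base) auto
qed

lemma val_eq:
  assumes "n > 0" "c \<noteq> 0" "unit (x ^ n / to_ac c)"
  shows "val x = root n (absv c)"
proof -
  have "x \<noteq> 0"
    using assms by (auto simp: unit_def)
  have "(SOME r. \<exists>n c. n > 0 \<and> c \<noteq> 0 \<and> unit (x ^ n / to_ac c) \<and> r = root n (absv c)) = root n (absv c)"
    by (rule some_equality) (use assms val_unique in blast)+
  thus ?thesis
    using \<open>x \<noteq> 0\<close> by (simp add: val_def)
qed

lemma val_0 [simp]: "val 0 = 0"
  by (simp add: val_def)

lemma val_pos: "x \<noteq> 0 \<Longrightarrow> val x > 0"
  by (rule exists_value[of x]) (auto simp: val_eq real_root_gt_zero order.not_eq_order_implies_strict[of 0])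

lemma val_to_ac: "val (to_ac a) = absv a"
proof (cases "a = 0")
  case False
  thus ?thesis
    using val_eq[of 1 a "to_ac a"] unit_to_ac[of 1] by simp
qed auto

lemma val_power_eq:
  assumes "n > 0" "c \<noteq> 0" "unit (x ^ n / to_ac c)"
  shows "val x ^ n = absv c"
  using val_eq[OF assms] assms by simp

lemma val_mult: "val (x * y) = val x * val y"
proof (cases "x = 0 \<or> y = 0")
  case False
  obtain n c where x: "n > 0" "c \<noteq> 0" "unit (x ^ n / to_ac c)"
    using exists_value[of x] False by blast
  obtain m d where y: "m > 0" "d \<noteq> 0" "unit (y ^ m / to_ac d)"
    using exists_value[of y] False by blast
  have "unit ((x ^ n / to_ac c) ^ m * (y ^ m / to_ac d) ^ n)"
    by (intro unit_mult unit_power x y)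
  also have "(x ^ n / to_ac c) ^ m * (y ^ m / to_ac d) ^ n = (x * y) ^ (n * m) / to_ac (c ^ m * d ^ n)"
    by (simp add: power_divide power_mult_distrib mult.commute flip: power_mult)
  finally have "val (x * y) ^ (n * m) = absv (c ^ m * d ^ n)"
    using x y by (intro val_power_eq) auto
  also have "\<dots> = (val x ^ n) ^ m * (val y ^ m) ^ n"
    using val_power_eq[OF x] val_power_eq[OF y] by (simp add: absv_mult absv_power)
  also have "\<dots> = (val x * val y) ^ (n * m)"
    by (simp add: power_mult_distrib mult.commute flip: power_mult)
  finally show ?thesis
    using x y val_pos[of x] val_pos[of y] val_pos[of "x * y"] False
    by (subst (asm) power_eq_iff_eq_base) auto
qed auto

lemma in_iff_val_le: "x \<in> R \<longleftrightarrow> val x \<le> 1"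
proof (cases "x = 0")
  case False
  obtain n c where x: "n > 0" "c \<noteq> 0" "unit (x ^ n / to_ac c)"
    using exists_value[OF False] by blast
  have "x \<in> R \<longleftrightarrow> x ^ n \<in> R"
  proof
    assume *: "x ^ n \<in> R"
    show "x \<in> R"
    proof (rule ccontr)
      assume "x \<notin> R"
      hence "inverse x \<in> R"
        using in_or_inverse_in by blast
      hence "x ^ n * inverse x ^ (n - 1) \<in> R"
        using * by (intro mult_in power_in[of "inverse x"])
      also have "x ^ n * inverse x ^ (n - 1) = x"
        using False x(1) by (cases n) (auto simp: power_inverse)
      finally show False
        using \<open>x \<notin> R\<close> by contradiction
    qed
  qed (auto intro: power_in)
  also have "\<dots> \<longleftrightarrow> to_ac c \<in> R"
  proof
    assume "x ^ n \<in> R"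
    hence "x ^ n * inverse (x ^ n / to_ac c) \<in> R"
      using x by (intro mult_in) (auto simp: unit_def)
    thus "to_ac c \<in> R"
      using False by simp
  next
    assume "to_ac c \<in> R"
    hence "to_ac c * (x ^ n / to_ac c) \<in> R"
      using x by (intro mult_in) (auto simp: unit_def)
    thus "x ^ n \<in> R"
      using x by simp
  qed
  also have "\<dots> \<longleftrightarrow> absv c \<le> 1"
    using base_in base_le by blast
  also have "absv c = val x ^ n"
    using val_power_eq[OF x] by simp
  also have "val x ^ n \<le> 1 \<longleftrightarrow> val x \<le> 1"
    using power_mono_iff[of "val x" 1 n] x val_pos[OF False] by simp
  finally show ?thesis .
qed (auto simp: zero_in)

lemma val_add_le_max: "val (x + y) \<le> max (val x) (val y)"
proof -
  have aux: "val (u + w) \<le> max (val u) (val w)" if "val u \<le> val w" for u w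
  proof (cases "w = 0")
    case True
    thus ?thesis
      using that val_pos[of u] by (cases "u = 0") auto
  next
    case False
    have eq: "val u = val (u / w) * val w"
      using val_mult[of "u / w" w] False by simp
    hence "val (u / w) \<le> 1"
      using that val_pos[OF False] by (simp add: mult_le_cancel_right1)
    hence "1 + u / w \<in> R"
      by (intro add_in one_in) (simp add: in_iff_val_le)
    hence "val (1 + u / w) * val w \<le> 1 * val w"
      using val_pos[OF False] by (intro mult_right_mono) (auto simp: in_iff_val_le)
    also have "val (1 + u / w) * val w = val (u + w)"
      using False by (simp add: field_simps flip: val_mult)
    finally show ?thesis
      by simp
  qed
  show ?thesis
    using aux[of x y] aux[of y x] by (cases "val x \<le> val y") (auto simp: add.commute max.commute)
qed

end

definition extends_absv :: "('a :: nonarch_field alg_closure \<Rightarrow> real) \<Rightarrow> bool" where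
  "extends_absv v \<longleftrightarrow> (\<forall>x. v (to_ac x) = absv x) \<and> (\<forall>x. v x \<ge> 0) \<and> (\<forall>x. v x = 0 \<longleftrightarrow> x = 0) \<and>
     (\<forall>x y. v (x * y) = v x * v y) \<and> (\<forall>x y. v (x + y) \<le> max (v x) (v y))"

lemma extends_absv_exists: "\<exists>v. extends_absv (v :: 'a :: nonarch_field alg_closure \<Rightarrow> real)"
proof -
  have "\<exists>R\<in>{R :: 'a alg_closure set. lies_over R}. \<forall>S\<in>{R. lies_over R}. R \<subseteq> S \<longrightarrow> S = R"
  proof (rule subset_Zorn_nonempty)
    have "lies_over (to_ac ` {x :: 'a. absv x \<le> 1})"
    proof
      fix x y :: "'a alg_closure"
      assume "x \<in> to_ac ` {x :: 'a. absv x \<le> 1}" "y \<in> to_ac ` {x :: 'a. absv x \<le> 1}"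
      then obtain a b where ab: "x = to_ac a" "y = to_ac b" "absv a \<le> 1" "absv b \<le> 1"
        by blast
      have "absv (a + b) \<le> 1" "absv (a * b) \<le> 1"
        using ab absv_add_le_max[of a b] by (auto simp: absv_mult mult_le_one)
      moreover have "x + y = to_ac (a + b)" "x * y = to_ac (a * b)"
        by (simp_all add: ab)
      ultimately show "x + y \<in> to_ac ` {x :: 'a. absv x \<le> 1}" "x * y \<in> to_ac ` {x :: 'a. absv x \<le> 1}"
        by blast+
    qed auto
    thus "{R :: 'a alg_closure set. lies_over R} \<noteq> {}"
      by blast
  next
    fix \<C> :: "'a alg_closure set set"
    assume ne: "\<C> \<noteq> {}" and chain: "subset.chain {R. lies_over R} \<C>"
    have lo: "lies_over R" if "R \<in> \<C>" for R
      using chain that by (auto simp: subset.chain_def)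
    have "lies_over (\<Union>\<C>)"
    proof
      fix x y :: "'a alg_closure"
      assume "x \<in> \<Union>\<C>" "y \<in> \<Union>\<C>"
      then obtain R S where RS: "R \<in> \<C>" "x \<in> R" "S \<in> \<C>" "y \<in> S"
        by blast
      have "R \<subseteq> S \<or> S \<subseteq> R"
        using chain RS by (auto simp: subset_chain_def)
      then obtain Q where "Q \<in> \<C>" "x \<in> Q" "y \<in> Q"
        using RS by blast
      thus "x + y \<in> \<Union>\<C>" "x * y \<in> \<Union>\<C>"
        using lies_over.add_in[OF lo] lies_over.mult_in[OF lo] by blast+
    qed (use ne lies_over.base_in[OF lo] lies_over.base_le[OF lo] in blast)+
    thus "\<Union>\<C> \<in> {R. lies_over R}"
      by simp
  qed
  then obtain R :: "'a alg_closure set" where "lies_over R" "\<And>S. lies_over S \<Longrightarrow> R \<subseteq> S \<Longrightarrow> S = R"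
    by blast
  then interpret maximal_lies_over R
    by (simp add: maximal_lies_over_def maximal_lies_over_axioms_def)
  have "val x = 0 \<longleftrightarrow> x = 0" "val x \<ge> 0" for x
    using val_pos[of x] by (cases "x = 0"; simp)+
  hence "extends_absv val"
    by (simp add: extends_absv_def val_to_ac val_mult val_add_le_max)
  thus ?thesis
    by blast
qed

text \<open>
  If the base field is complete (as the field of \<open>p\<close>-adic numbers is), the extension is unique, so
  that the choice below is no choice at all.
\<close>

instantiation alg_closure :: (nonarch_field) nonarch_field
begin

definition absv_alg_closure :: "'a alg_closure \<Rightarrow> real"
  where "absv_alg_closure = (SOME v. extends_absv v)"

definition dist_alg_closure :: "'a alg_closure \<Rightarrow> 'a alg_closure \<Rightarrow> real"
  where "dist_alg_closure x y = absv (x - y)"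

definition uniformity_alg_closure :: "('a alg_closure \<times> 'a alg_closure) filter"
  where "uniformity_alg_closure = (INF e\<in>{0 <..}. principal {(x, y). dist x y < e})"

definition open_alg_closure :: "'a alg_closure set \<Rightarrow> bool"
  where "open_alg_closure U \<longleftrightarrow> (\<forall>x\<in>U. \<forall>\<^sub>F (x', y) in uniformity. x' = x \<longrightarrow> y \<in> U)"

instance
proof
  have "extends_absv (absv :: 'a alg_closure \<Rightarrow> real)"
    unfolding absv_alg_closure_def using extends_absv_exists by (rule someI_ex)
  hence *: "absv x \<ge> 0" "absv x = 0 \<longleftrightarrow> x = 0" "absv (x * y) = absv x * absv y"
       "absv (x + y) \<le> max (absv x) (absv y)" for x y :: "'a alg_closure"
    by (auto simp: extends_absv_def)
  fix x y z :: "'a alg_closure"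
  show "absv x \<ge> 0" "absv x = 0 \<longleftrightarrow> x = 0" "absv (x * y) = absv x * absv y"
       "absv (x + y) \<le> max (absv x) (absv y)"
    by (rule *)+
  show "dist x y = absv (x - y)"
    by (simp add: dist_alg_closure_def)
  show "dist x y = 0 \<longleftrightarrow> x = y"
    by (simp add: dist_alg_closure_def *)
  show "dist x y \<le> dist x z + dist y z"
    unfolding dist_alg_closure_def by (rule ultrametric_imp_triangle2) (rule *)+
qed (fact uniformity_alg_closure_def open_alg_closure_def)+

end

lemma absv_to_ac [simp]: "absv (to_ac x) = absv x"
  using someI_ex[OF extends_absv_exists] unfolding absv_alg_closure_def extends_absv_def by blast

section \<open>The \<open>p\<close>-adic numbers\<close>

definition padic_absv :: "nat \<Rightarrow> rat \<Rightarrow> real" where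
  "padic_absv p r = (if r = 0 then 0 else
     real p powi (int (multiplicity (int p) (snd (quotient_of r))) -
                  int (multiplicity (int p) (fst (quotient_of r)))))"

context
  fixes p :: nat
  assumes prime: "prime p"
begin

lemma padic_absv_Fract:
  assumes "a \<noteq> 0" "b \<noteq> 0"
  shows "padic_absv p (Rat.Fract a b) =
           real p powi (int (multiplicity (int p) b) - int (multiplicity (int p) a))"
proof -
  obtain c d where cd: "quotient_of (Rat.Fract a b) = (c, d)"
    by (cases "quotient_of (Rat.Fract a b)") auto
  have "d > 0"
    using quotient_of_denom_pos[OF cd] .
  have nz: "Rat.Fract a b \<noteq> 0"
    using assms by (simp add: Zero_rat_def eq_rat)
  have "Rat.Fract a b = Rat.Fract c d"
    using quotient_of_div[OF cd] by (simp add: Fract_of_int_quotient)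
  hence eq: "a * d = c * b"
    using assms \<open>d > 0\<close> by (simp add: eq_rat)
  hence "c \<noteq> 0"
    using assms \<open>d > 0\<close> by auto
  have "prime_elem (int p)"
    using prime by simp
  hence "multiplicity (int p) a + multiplicity (int p) d = multiplicity (int p) c + multiplicity (int p) b"
    using assms \<open>c \<noteq> 0\<close> \<open>d > 0\<close> eq
    by (metis less_irrefl prime_elem_multiplicity_mult_distrib)
  hence "int (multiplicity (int p) d) - int (multiplicity (int p) c) =
         int (multiplicity (int p) b) - int (multiplicity (int p) a)"
    by linarith
  thus ?thesis
    using nz by (simp add: padic_absv_def cd)
qed

lemma padic_absv_mult: "padic_absv p (x * y) = padic_absv p x * padic_absv p y"
proof (cases "x = 0 \<or> y = 0")
  case False
  obtain a b where x: "x = Rat.Fract a b" "b > 0"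
    by (cases x) auto
  obtain c d where y: "y = Rat.Fract c d" "d > 0"
    by (cases y) auto
  have nz: "a \<noteq> 0" "c \<noteq> 0"
    using False x y by (auto simp: rat_number_collapse)
  have pe: "prime_elem (int p)"
    using prime by simp
  have "padic_absv p (x * y) = padic_absv p (Rat.Fract (a * c) (b * d))"
    by (simp add: x y)
  also have "\<dots> = padic_absv p x * padic_absv p y"
    using nz x y prime
    by (simp add: padic_absv_Fract prime_elem_multiplicity_mult_distrib[OF pe] prime_gt_0_nat
             add_diff_add flip: power_int_add)
  finally show ?thesis .
qed (auto simp: padic_absv_def)

lemma padic_absv_add: "padic_absv p (x + y) \<le> max (padic_absv p x) (padic_absv p y)"
proof -
  have ge0: "padic_absv p z \<ge> 0" for z
    by (simp add: padic_absv_def)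
  show ?thesis
  proof (cases "x = 0 \<or> y = 0 \<or> x + y = 0")
    case True
    thus ?thesis
    proof (elim disjE)
      assume "x + y = 0"
      hence "padic_absv p (x + y) = 0"
        by (simp add: padic_absv_def)
      thus ?thesis
        using ge0[of x] by simp
    qed auto
  next
    case False
    obtain a b where x: "x = Rat.Fract a b" "b > 0"
      by (cases x) auto
    obtain c d where y: "y = Rat.Fract c d" "d > 0"
      by (cases y) auto
    have sum: "x + y = Rat.Fract (a * d + c * b) (b * d)"
      using x y by simp
    have nz: "a \<noteq> 0" "c \<noteq> 0" "a * d + c * b \<noteq> 0"
      using False x y sum by (auto simp: rat_number_collapse)
    have pe: "prime_elem (int p)"
      using prime by simp
    let ?m = "multiplicity (int p)"
    define k where "k = min (?m (a * d)) (?m (c * b))"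
    have "int p ^ k dvd a * d" "int p ^ k dvd c * b"
      unfolding k_def by (auto intro: multiplicity_dvd')
    hence "int p ^ k dvd a * d + c * b"
      by simp
    hence le: "k \<le> ?m (a * d + c * b)"
      using nz prime by (intro multiplicity_geI) (auto simp: prime_nat_iff)
    have m: "?m (a * d) = ?m a + ?m d" "?m (c * b) = ?m c + ?m b" "?m (b * d) = ?m b + ?m d"
      using nz x y by (simp_all add: prime_elem_multiplicity_mult_distrib[OF pe])
    have p1: "real p \<ge> 1"
      using prime_ge_1_nat[OF prime] by simp
    have "padic_absv p (x + y) = real p powi (int (?m (b * d)) - int (?m (a * d + c * b)))"
      unfolding sum using nz x y by (intro padic_absv_Fract) auto
    also have "\<dots> \<le> real p powi (int (?m (b * d)) - int k)"
      using le p1 by (intro power_int_increasing) auto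
    also have "\<dots> \<le> max (padic_absv p x) (padic_absv p y)"
    proof (cases "?m (a * d) \<le> ?m (c * b)")
      case True
      hence "int (?m (b * d)) - int k = int (?m b) - int (?m a)"
        by (simp add: k_def m)
      thus ?thesis
        using x nz by (simp add: padic_absv_Fract)
    next
      case False
      hence "int (?m (b * d)) - int k = int (?m d) - int (?m c)"
        by (simp add: k_def m)
      thus ?thesis
        using y nz by (simp add: padic_absv_Fract)
    qed
    finally show ?thesis .
  qed
qed

lemma padic_absv_ge_0: "padic_absv p x \<ge> 0"
  by (simp add: padic_absv_def)

lemma padic_absv_eq_0_iff: "padic_absv p x = 0 \<longleftrightarrow> x = 0"
  using prime_gt_0_nat[OF prime] by (simp add: padic_absv_def)

end

text \<open>
  A copy of the rationals that carries the \<open>p\<close>-adic instead of the Archimedean metric. The prime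
  \<open>p\<close> is the cardinality of the type parameter.
\<close>

typedef 'p padic_rat = "UNIV :: rat set"
  by simp

setup_lifting type_definition_padic_rat

instantiation padic_rat :: (type) field
begin

lift_definition zero_padic_rat :: "'a padic_rat" is 0 .
lift_definition one_padic_rat :: "'a padic_rat" is 1 .
lift_definition plus_padic_rat :: "'a padic_rat \<Rightarrow> 'a padic_rat \<Rightarrow> 'a padic_rat" is "(+)" .
lift_definition minus_padic_rat :: "'a padic_rat \<Rightarrow> 'a padic_rat \<Rightarrow> 'a padic_rat" is "(-)" .
lift_definition uminus_padic_rat :: "'a padic_rat \<Rightarrow> 'a padic_rat" is uminus .
lift_definition times_padic_rat :: "'a padic_rat \<Rightarrow> 'a padic_rat \<Rightarrow> 'a padic_rat" is "(*)" .
lift_definition inverse_padic_rat :: "'a padic_rat \<Rightarrow> 'a padic_rat" is inverse .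
lift_definition divide_padic_rat :: "'a padic_rat \<Rightarrow> 'a padic_rat \<Rightarrow> 'a padic_rat" is "(/)" .

instance
  by (standard; transfer; simp add: algebra_simps divide_inverse)

end

instance padic_rat :: (type) field_char_0
proof
  have *: "Rep_padic_rat (of_nat n :: 'a padic_rat) = of_nat n" for n
    by (induction n) (simp_all add: zero_padic_rat.rep_eq one_padic_rat.rep_eq plus_padic_rat.rep_eq)
  show "inj (of_nat :: nat \<Rightarrow> 'a padic_rat)"
    by (rule injI) (metis * of_nat_eq_iff)
qed

instantiation padic_rat :: (prime_card) nonarch_field
begin

lift_definition absv_padic_rat :: "'a padic_rat \<Rightarrow> real" is "padic_absv CARD('a)" .

definition dist_padic_rat :: "'a padic_rat \<Rightarrow> 'a padic_rat \<Rightarrow> real"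
  where "dist_padic_rat x y = absv (x - y)"

definition uniformity_padic_rat :: "('a padic_rat \<times> 'a padic_rat) filter"
  where "uniformity_padic_rat = (INF e\<in>{0 <..}. principal {(x, y). dist x y < e})"

definition open_padic_rat :: "'a padic_rat set \<Rightarrow> bool"
  where "open_padic_rat U \<longleftrightarrow> (\<forall>x\<in>U. \<forall>\<^sub>F (x', y) in uniformity. x' = x \<longrightarrow> y \<in> U)"

instance
proof
  have *: "absv x \<ge> 0" "absv x = 0 \<longleftrightarrow> x = 0" "absv (x * y) = absv x * absv y"
       "absv (x + y) \<le> max (absv x) (absv y)" for x y :: "'a padic_rat"
    by (transfer; rule padic_absv_ge_0 padic_absv_eq_0_iff padic_absv_mult padic_absv_add; rule prime_card)+
  fix x y z :: "'a padic_rat"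
  show "absv x \<ge> 0" "absv x = 0 \<longleftrightarrow> x = 0" "absv (x * y) = absv x * absv y"
       "absv (x + y) \<le> max (absv x) (absv y)"
    by (rule *)+
  show "dist x y = absv (x - y)"
    by (simp add: dist_padic_rat_def)
  show "dist x y = 0 \<longleftrightarrow> x = y"
    by (simp add: dist_padic_rat_def *)
  show "dist x y \<le> dist x z + dist y z"
    unfolding dist_padic_rat_def by (rule ultrametric_imp_triangle2) (rule *)+
qed (fact uniformity_padic_rat_def open_padic_rat_def)+

end

type_synonym 'p padic = "'p padic_rat completion"

text \<open>\<open>\<complex>\<^sub>p\<close>, the completion of the algebraic closure of \<open>\<rat>\<^sub>p\<close>.\<close>

type_synonym 'p padic_complex = "'p padic alg_closure completion"

definition padic_int :: "'p :: prime_card padic set" where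
  "padic_int = {x. absv x \<le> 1}"

definition to_padic_complex :: "'p :: prime_card padic \<Rightarrow> 'p padic_complex" where
  "to_padic_complex x = to_completion (to_ac x)"

section \<open>The Volkenborn integral\<close>

text \<open>
  Functions on \<open>\<int>\<^sub>p\<close> are represented by functions on \<open>\<rat>\<^sub>p\<close>; the two definitions below look only
  at their values on \<open>\<int>\<^sub>p\<close>.
\<close>

definition uniformly_differentiable :: "('p :: prime_card padic \<Rightarrow> 'p padic_complex) \<Rightarrow> bool" where
  "uniformly_differentiable f \<longleftrightarrow>
     (\<exists>f'. \<forall>\<epsilon>>0. \<exists>\<delta>>0. \<forall>x\<in>padic_int. \<forall>y\<in>padic_int. x \<noteq> y \<and> dist x y < \<delta> \<longrightarrow>
        dist ((f x - f y) / (to_padic_complex x - to_padic_complex y)) (f' x) < \<epsilon>)"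

definition has_volkenborn_integral ::
  "('p :: prime_card padic \<Rightarrow> 'p padic_complex) \<Rightarrow> 'p padic_complex \<Rightarrow> bool" where
  "has_volkenborn_integral f I \<longleftrightarrow> uniformly_differentiable f \<and>
     (\<lambda>N. 1 / of_nat (CARD('p) ^ N) * (\<Sum>x<CARD('p) ^ N. f (of_nat x))) \<longlonglongrightarrow> I"

lemma has_volkenborn_integral_unique:
  "has_volkenborn_integral f I \<Longrightarrow> has_volkenborn_integral f J \<Longrightarrow> I = J"
  unfolding has_volkenborn_integral_def by (blast intro: LIMSEQ_unique)

section \<open>Bernstein polynomials and Bernoulli numbers\<close>

definition bernstein :: "nat \<Rightarrow> nat \<Rightarrow> 'a :: comm_ring_1 \<Rightarrow> 'a" where
  "bernstein k n x = of_nat (n choose k) * x ^ k * (1 - x) ^ (n - k)"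

definition bernoulli :: "nat \<Rightarrow> rat" where
  "bernoulli m = fact m * fps_nth (fps_X / (fps_exp 1 - 1)) m"

lemma bernoulli_gf: "Abs_fps (\<lambda>m. bernoulli m / fact m) * (fps_exp 1 - 1) = fps_X"
proof -
  have "subdegree (fps_exp 1 - 1 :: rat fps) = 1"
    by (rule subdegreeI) auto
  hence "(fps_exp 1 - 1 :: rat fps) dvd fps_X"
    by (subst fps_dvd_iff) auto
  hence "fps_X / (fps_exp 1 - 1) * (fps_exp 1 - 1) = (fps_X :: rat fps)"
    by simp
  also have "fps_X / (fps_exp 1 - 1) = Abs_fps (\<lambda>m. bernoulli m / fact m)"
    by (simp add: fps_eq_iff bernoulli_def)
  finally show ?thesis .
qed

end

theory Submission
  imports Defs
begin

text \<open>
  Since \<open>k \<le> n\<^sub>i\<close>, the integrand collapses to a constant times \<open>x\<^bsup>M k\<^esup> (1 - x)\<^sup>D\<close>, which the binomial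
  theorem turns into a combination of monomials; so by linearity everything reduces to
  \<open>\<integral> x\<^sup>m = B\<^sub>m\<close>. Multiplying the generating function of the Bernoulli numbers by
  \<open>(e\<^sup>t - 1) \<Sum>\<^sub>x\<^sub><\<^sub>q e\<^bsup>x t\<^esup> = e\<^bsup>q t\<^esup> - 1\<close> yields Faulhaber's formula, which exhibits
  \<open>q\<^sup>-\<^sup>1 \<Sum>\<^sub>x\<^sub><\<^sub>q x\<^sup>m\<close> as a polynomial in \<open>q\<close> with constant term \<open>B\<^sub>m\<close>; and \<open>q = p\<^sup>N\<close> tends to \<open>0\<close>
  \<open>p\<close>-adically.
\<close>

section \<open>Faulhaber's formula\<close>

lemma sum_powers_bernoulli:
  assumes "q > 0"
  shows "1 / of_nat q * (\<Sum>x<q. of_nat x ^ m) =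
           bernoulli m + (\<Sum>j<m. fact m / (fact j * fact (m + 1 - j)) * bernoulli j * of_nat q ^ (m - j))"
proof -
  define E :: "rat fps" where "E = fps_exp 1"
  define B where "B = Abs_fps (\<lambda>m. bernoulli m / fact m)"
  have E_power: "E ^ x = fps_exp (of_nat x)" for x
    by (simp add: E_def fps_exp_power_mult)
  have "fps_X * (\<Sum>x<q. E ^ x) = B * ((E - 1) * (\<Sum>x<q. E ^ x))"
    using bernoulli_gf by (simp add: B_def E_def mult.assoc [symmetric])
  also have "(E - 1) * (\<Sum>x<q. E ^ x) = E ^ q - 1"
    by (rule power_diff_1_eq [symmetric])
  \<comment> \<open>The factor \<open>fps_X\<close> shifts indices by one, so coefficient
    \<open>Suc m\<close> on the left carries the \<open>m\<close>-th powers.\<close>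
  finally have "fps_nth (fps_X * (\<Sum>x<q. E ^ x)) (Suc m) = fps_nth (B * (E ^ q - 1)) (Suc m)"
    by simp
  also have "fps_nth (fps_X * (\<Sum>x<q. E ^ x)) (Suc m) = (\<Sum>x<q. of_nat x ^ m) / fact m"
    by (simp add: E_power fps_sum_nth sum_divide_distrib)
  \<comment> \<open>The summand \<open>j = Suc m\<close> disappears because \<open>E ^ q - 1\<close>
    has constant coefficient 0.\<close>
  also have "fps_nth (B * (E ^ q - 1)) (Suc m) =
      (\<Sum>j\<le>m. bernoulli j / fact j * (of_nat q ^ (m + 1 - j) / fact (m + 1 - j)))"
    by (auto simp: fps_mult_nth E_power B_def atLeast0AtMost intro!: sum.cong)
  finally have *: "(\<Sum>x<q. of_nat x ^ m) =
      fact m * (\<Sum>j\<le>m. bernoulli j / fact j * (of_nat q ^ (m + 1 - j) / fact (m + 1 - j)))"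
    by (simp add: field_simps)
  have "1 / of_nat q * (\<Sum>x<q. of_nat x ^ m) =
      (\<Sum>j\<le>m. fact m / (fact j * fact (m + 1 - j)) * bernoulli j * of_nat q ^ (m - j))"
    unfolding * sum_distrib_left
    using assms by (intro sum.cong) (auto simp: Suc_diff_le field_simps)
  \<comment> \<open>The summand \<open>j = m\<close> is exactly \<open>bernoulli m\<close>; every
    other one keeps a positive power of \<open>q\<close>.\<close>
  thus ?thesis
    by (simp add: lessThan_Suc_atMost [symmetric])
qed

section \<open>Limits and absolute values\<close>

text \<open>Reduces limits to real limits of absolute values, so that sums and scalar multiples are
  handled by the closure rules of \<open>null_seq\<close>.\<close>

lemma LIMSEQ_iff_null_seq:
  fixes L :: "'a :: nonarch_field"
  shows "F \<longlonglongrightarrow> L \<longleftrightarrow> null_seq (\<lambda>n. F n - L)"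
  unfolding null_seq_def tendsto_dist_iff [of F] by (simp add: dist_absv)

lemma null_seq_const_mult:
  assumes "null_seq F"
  shows "null_seq (\<lambda>n. c * F n)"
  using null_seq_mult [OF Cauchy_const_absv assms] .

lemma null_seq_sum:
  assumes "\<And>i. i \<in> A \<Longrightarrow> null_seq (F i)"
  shows "null_seq (\<lambda>n. \<Sum>i\<in>A. F i n)"
  using assms by (induction A rule: infinite_finite_induct) (auto intro: null_seq_add)

text \<open>By the ultrametric inequality the bound does not grow with the number of terms;
  \<open>b \<ge> 0\<close> covers the empty sum.\<close>

lemma absv_sum_le:
  fixes f :: "'b \<Rightarrow> 'a :: nonarch_field"
  assumes "\<And>i. i \<in> A \<Longrightarrow> absv (f i) \<le> b" "b \<ge> 0"
  shows "absv (sum f A) \<le> b"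
  using assms(1)
proof (induction A rule: infinite_finite_induct)
  case (insert i A)
  thus ?case
    using absv_add_le_max [of "f i" "sum f A"] by fastforce
qed (use assms(2) in auto)

text \<open>Factoring out \<open>x - y\<close> leaves a sum of products of elements of the closed
  unit ball, which is again in that ball.\<close>

lemma absv_power_diff_le:
  fixes x y :: "'a :: nonarch_field"
  assumes "absv x \<le> 1" "absv y \<le> 1"
  shows "absv (x ^ n - y ^ n) \<le> absv (x - y)"
proof -
  have "absv (\<Sum>i<n. x ^ i * y ^ (n - Suc i)) \<le> 1"
    by (rule absv_sum_le) (use assms in \<open>auto simp: absv_mult absv_power intro!: mult_le_one power_le_one\<close>)
  thus ?thesis
    unfolding power_diff_sumr2
    by (simp add: absv_mult mult_left_le mult.commute [of "y ^ _"])
qed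

lemma to_padic_complex_of_nat [simp]: "to_padic_complex (of_nat n) = of_nat n"
  by (simp add: to_padic_complex_def)

lemma to_padic_complex_diff: "to_padic_complex (x - y) = to_padic_complex x - to_padic_complex y"
  by (simp add: to_padic_complex_def)

lemma absv_to_padic_complex [simp]: "absv (to_padic_complex x) = absv x"
  by (simp add: to_padic_complex_def)

lemma to_padic_complex_eq_iff [simp]: "to_padic_complex x = to_padic_complex y \<longleftrightarrow> x = y"
  by (simp add: to_padic_complex_def)

lemma absv_of_nat_CARD_padic_rat:
  "absv (of_nat CARD('p) :: 'p :: prime_card padic_rat) = 1 / real CARD('p)"
proof -
  have rep: "Rep_padic_rat (of_nat n :: 'p padic_rat) = of_nat n" for n
    by (induction n) (simp_all add: zero_padic_rat.rep_eq one_padic_rat.rep_eq plus_padic_rat.rep_eq)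
  have prime: "prime CARD('p)"
    by (rule prime_card)
  hence gt: "CARD('p) > 1"
    by (rule prime_gt_1_nat)
  have "absv (of_nat CARD('p) :: 'p padic_rat) = padic_absv CARD('p) (Rat.Fract (int CARD('p)) 1)"
    by (simp add: absv_padic_rat.rep_eq rep of_nat_rat)
  also have "\<dots> = real CARD('p) powi (-1)"
    using gt by (subst padic_absv_Fract [OF prime]) (auto simp: multiplicity_self)
  finally show ?thesis
    by (simp add: power_int_minus field_simps)
qed

text \<open>Every embedding on the way from the rationals to C_p preserves both \<open>absv\<close>
  and the natural numbers.\<close>

lemma absv_of_nat_CARD:
  "absv (of_nat CARD('p) :: 'p :: prime_card padic_complex) = 1 / real CARD('p)"
proof -
  have "absv (of_nat CARD('p) :: 'p padic_complex) = absv (of_nat CARD('p) :: 'p padic)"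
    by (metis absv_to_padic_complex to_padic_complex_of_nat)
  also have "\<dots> = absv (of_nat CARD('p) :: 'p padic_rat)"
    by (metis absv_to_completion to_completion_of_nat)
  finally show ?thesis
    by (simp add: absv_of_nat_CARD_padic_rat)
qed

text \<open>Swapping the exponents \<open>N\<close> and \<open>e\<close> exhibits the absolute
  values as a geometric sequence, whose ratio is below 1 because \<open>e > 0\<close>.\<close>

lemma null_seq_CARD_power:
  assumes "e > 0"
  shows "null_seq (\<lambda>N. of_nat (CARD('p) ^ N) ^ e :: 'p :: prime_card padic_complex)"
proof -
  have gt: "CARD('p) > 1"
    using prime_card by (rule prime_gt_1_nat)
  have "absv (of_nat (CARD('p) ^ N) ^ e :: 'p padic_complex) = ((1 / real CARD('p)) ^ e) ^ N" for N
    unfolding of_nat_power absv_power absv_of_nat_CARD by (metis power_mult mult.commute)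
  moreover have "(1 / real CARD('p)) ^ e < 1"
    using gt assms by (simp add: power_less_one_iff)
  ultimately show ?thesis
    unfolding null_seq_def by (simp only:) (intro LIMSEQ_power_zero, simp)
qed

section \<open>Linearity of the Volkenborn integral\<close>

lemma has_volkenborn_integral_0: "has_volkenborn_integral (\<lambda>_. 0) 0"
  by (auto simp: has_volkenborn_integral_def uniformly_differentiable_def intro!: exI [of _ "\<lambda>_. 0"] exI [of _ 1])

lemma uniformly_differentiable_add:
  assumes "uniformly_differentiable f" "uniformly_differentiable g"
  shows "uniformly_differentiable (\<lambda>x. f x + g x)"
proof -
  from assms obtain f' g' where
    f': "\<And>\<epsilon>. \<epsilon> > 0 \<Longrightarrow> \<exists>\<delta>>0. \<forall>x\<in>padic_int. \<forall>y\<in>padic_int. x \<noteq> y \<and> dist x y < \<delta> \<longrightarrow>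
        dist ((f x - f y) / (to_padic_complex x - to_padic_complex y)) (f' x) < \<epsilon>" and
    g': "\<And>\<epsilon>. \<epsilon> > 0 \<Longrightarrow> \<exists>\<delta>>0. \<forall>x\<in>padic_int. \<forall>y\<in>padic_int. x \<noteq> y \<and> dist x y < \<delta> \<longrightarrow>
        dist ((g x - g y) / (to_padic_complex x - to_padic_complex y)) (g' x) < \<epsilon>"
    unfolding uniformly_differentiable_def by metis
  show ?thesis
    unfolding uniformly_differentiable_def
  proof (intro exI [of _ "\<lambda>x. f' x + g' x"] allI impI)
    fix \<epsilon> :: real
    assume \<epsilon>: "\<epsilon> > 0"
    \<comment> \<open>No halving of \<open>\<epsilon>\<close> is needed: the ultrametric inequality
      bounds the error of the sum by the larger of the two errors.\<close>
    obtain \<delta>1 where \<delta>1: "\<delta>1 > 0" "\<And>x y. x \<in> padic_int \<Longrightarrow> y \<in> padic_int \<Longrightarrow> x \<noteq> y \<Longrightarrow> dist x y < \<delta>1 \<Longrightarrow>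
        dist ((f x - f y) / (to_padic_complex x - to_padic_complex y)) (f' x) < \<epsilon>"
      using f' [OF \<epsilon>] by metis
    obtain \<delta>2 where \<delta>2: "\<delta>2 > 0" "\<And>x y. x \<in> padic_int \<Longrightarrow> y \<in> padic_int \<Longrightarrow> x \<noteq> y \<Longrightarrow> dist x y < \<delta>2 \<Longrightarrow>
        dist ((g x - g y) / (to_padic_complex x - to_padic_complex y)) (g' x) < \<epsilon>"
      using g' [OF \<epsilon>] by metis
    show "\<exists>\<delta>>0. \<forall>x\<in>padic_int. \<forall>y\<in>padic_int. x \<noteq> y \<and> dist x y < \<delta> \<longrightarrow>
        dist ((f x + g x - (f y + g y)) / (to_padic_complex x - to_padic_complex y)) (f' x + g' x) < \<epsilon>"
    proof (intro exI [of _ "min \<delta>1 \<delta>2"] conjI ballI impI)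
      fix x y :: "'a padic"
      assume xy: "x \<in> padic_int" "y \<in> padic_int" "x \<noteq> y \<and> dist x y < min \<delta>1 \<delta>2"
      let ?d = "to_padic_complex x - to_padic_complex y"
      have eq: "(f x + g x - (f y + g y)) / ?d - (f' x + g' x) =
            ((f x - f y) / ?d - f' x) + ((g x - g y) / ?d - g' x)"
        by (simp add: diff_divide_distrib add_divide_distrib)
      show "dist ((f x + g x - (f y + g y)) / ?d) (f' x + g' x) < \<epsilon>"
        unfolding dist_absv eq
        using \<delta>1(2) [of x y] \<delta>2(2) [of x y] xy
        by (intro le_less_trans [OF absv_add_le_max]) (auto simp: dist_absv)
    qed (use \<delta>1 \<delta>2 in auto)
  qed
qed

lemma uniformly_differentiable_const_mult:
  assumes "uniformly_differentiable f"
  shows "uniformly_differentiable (\<lambda>x. c * f x)"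
proof -
  from assms obtain f' where
    f': "\<And>\<epsilon>. \<epsilon> > 0 \<Longrightarrow> \<exists>\<delta>>0. \<forall>x\<in>padic_int. \<forall>y\<in>padic_int. x \<noteq> y \<and> dist x y < \<delta> \<longrightarrow>
        dist ((f x - f y) / (to_padic_complex x - to_padic_complex y)) (f' x) < \<epsilon>"
    unfolding uniformly_differentiable_def by metis
  show ?thesis
    unfolding uniformly_differentiable_def
  proof (intro exI [of _ "\<lambda>x. c * f' x"] allI impI)
    fix \<epsilon> :: real
    assume \<epsilon>: "\<epsilon> > 0"
    \<comment> \<open>Dividing by \<open>absv c + 1\<close> instead of \<open>absv c\<close> avoids
      a separate case \<open>c = 0\<close>.\<close>
    have pos: "absv c + 1 > 0"
      using absv_ge_0 [of c] by linarith
    with \<epsilon> have "\<epsilon> / (absv c + 1) > 0"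
      by simp
    from f' [OF this] obtain \<delta> where \<delta>: "\<delta> > 0"
      "\<And>x y. x \<in> padic_int \<Longrightarrow> y \<in> padic_int \<Longrightarrow> x \<noteq> y \<Longrightarrow> dist x y < \<delta> \<Longrightarrow>
        dist ((f x - f y) / (to_padic_complex x - to_padic_complex y)) (f' x) < \<epsilon> / (absv c + 1)"
      by metis
    show "\<exists>\<delta>>0. \<forall>x\<in>padic_int. \<forall>y\<in>padic_int. x \<noteq> y \<and> dist x y < \<delta> \<longrightarrow>
        dist ((c * f x - c * f y) / (to_padic_complex x - to_padic_complex y)) (c * f' x) < \<epsilon>"
    proof (intro exI [of _ \<delta>] conjI ballI impI)
      fix x y :: "'a padic"
      assume xy: "x \<in> padic_int" "y \<in> padic_int" "x \<noteq> y \<and> dist x y < \<delta>"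
      let ?d = "to_padic_complex x - to_padic_complex y"
      let ?r = "absv ((f x - f y) / ?d - f' x)"
      have eq: "(c * f x - c * f y) / ?d - c * f' x = c * ((f x - f y) / ?d - f' x)"
        by (simp add: diff_divide_distrib right_diff_distrib)
      have "absv c * ?r \<le> (absv c + 1) * ?r"
        by (intro mult_right_mono) auto
      also have "\<dots> < \<epsilon>"
        using \<delta>(2) [of x y] xy pos by (simp add: dist_absv pos_less_divide_eq mult.commute)
      finally show "dist ((c * f x - c * f y) / ?d) (c * f' x) < \<epsilon>"
        by (simp add: dist_absv eq absv_mult)
    qed (use \<delta> in auto)
  qed
qed

lemma has_volkenborn_integral_add:
  assumes "has_volkenborn_integral f I" "has_volkenborn_integral g J"
  shows "has_volkenborn_integral (\<lambda>x. f x + g x) (I + J)"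
  using assms uniformly_differentiable_add [of f g] null_seq_add
  unfolding has_volkenborn_integral_def LIMSEQ_iff_null_seq sum.distrib distrib_left add_diff_add
  by blast

lemma has_volkenborn_integral_const_mult:
  assumes "has_volkenborn_integral f I"
  shows "has_volkenborn_integral (\<lambda>x. c * f x) (c * I)"
  using assms uniformly_differentiable_const_mult [of f c] null_seq_const_mult [of _ c]
  unfolding has_volkenborn_integral_def LIMSEQ_iff_null_seq sum_distrib_left [symmetric]
    mult.left_commute [of _ c] right_diff_distrib [of c, symmetric]
  by blast

text \<open>For infinite \<open>A\<close> both sums are 0 by convention, so finiteness need not be
  assumed.\<close>

lemma has_volkenborn_integral_sum:
  assumes "\<And>i. i \<in> A \<Longrightarrow> has_volkenborn_integral (f i) (I i)"
  shows "has_volkenborn_integral (\<lambda>x. \<Sum>i\<in>A. f i x) (\<Sum>i\<in>A. I i)"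
  using assms
  by (induction A rule: infinite_finite_induct)
     (auto intro: has_volkenborn_integral_0 has_volkenborn_integral_add)

section \<open>Integrals of monomials\<close>

text \<open>The difference quotient is a homogeneous sum in \<open>u\<close> and \<open>v\<close>,
  and the derivative is the same sum at \<open>v = u\<close>. Termwise they differ by at most
  \<open>absv (v - u)\<close>, so \<open>\<delta> = \<epsilon>\<close> works.\<close>

lemma uniformly_differentiable_power:
  "uniformly_differentiable (\<lambda>x :: 'p :: prime_card padic. to_padic_complex x ^ m)"
  unfolding uniformly_differentiable_def
\<comment> \<open>For \<open>m = 0\<close> the exponent \<open>m - 1\<close> truncates to 0, but the
  factor \<open>of_nat m\<close> makes the derivative 0.\<close>
proof (intro exI [of _ "\<lambda>x. of_nat m * to_padic_complex x ^ (m - 1)"] allI impI)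
  fix \<epsilon> :: real
  assume \<epsilon>: "\<epsilon> > 0"
  show "\<exists>\<delta>>0. \<forall>x\<in>padic_int. \<forall>y\<in>padic_int. x \<noteq> y \<and> dist x y < \<delta> \<longrightarrow>
      dist ((to_padic_complex x ^ m - to_padic_complex y ^ m) / (to_padic_complex x - to_padic_complex y))
        (of_nat m * to_padic_complex (x :: 'p padic) ^ (m - 1)) < \<epsilon>"
  proof (intro exI [of _ \<epsilon>] conjI ballI impI)
    fix x y :: "'p padic"
    assume xy: "x \<in> padic_int" "y \<in> padic_int" "x \<noteq> y \<and> dist x y < \<epsilon>"
    define u v where "u = to_padic_complex x" and "v = to_padic_complex y"
    have uv: "absv u \<le> 1" "absv v \<le> 1" "u \<noteq> v"
      using xy by (auto simp: u_def v_def padic_int_def)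
    have "u ^ (m - 1) = u ^ i * u ^ (m - Suc i)" if "i < m" for i
      using that by (simp flip: power_add)
    hence "(\<Sum>i<m. u ^ i * u ^ (m - Suc i)) = (\<Sum>i<m. u ^ (m - 1))"
      by (intro sum.cong) auto
    hence "of_nat m * u ^ (m - 1) = (\<Sum>i<m. u ^ i * u ^ (m - Suc i))"
      by simp
    moreover have "(u ^ m - v ^ m) / (u - v) = (\<Sum>i<m. u ^ i * v ^ (m - Suc i))"
      using uv by (simp add: power_diff_sumr2 mult.commute)
    ultimately have "(u ^ m - v ^ m) / (u - v) - of_nat m * u ^ (m - 1) =
        (\<Sum>i<m. u ^ i * (v ^ (m - Suc i) - u ^ (m - Suc i)))"
      by (simp add: right_diff_distrib sum_subtractf)
    also have "absv \<dots> \<le> absv (v - u)"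
    proof (rule absv_sum_le)
      fix i
      have "absv u ^ i * absv (v ^ (m - Suc i) - u ^ (m - Suc i)) \<le> 1 * absv (v - u)"
        using uv by (intro mult_mono absv_power_diff_le power_le_one) auto
      thus "absv (u ^ i * (v ^ (m - Suc i) - u ^ (m - Suc i))) \<le> absv (v - u)"
        by (simp add: absv_mult absv_power)
    qed auto
    also have "absv (v - u) = dist x y"
      by (simp add: u_def v_def dist_absv absv_minus_commute [of x y] flip: to_padic_complex_diff)
    finally show "dist ((to_padic_complex x ^ m - to_padic_complex y ^ m) /
        (to_padic_complex x - to_padic_complex y)) (of_nat m * to_padic_complex x ^ (m - 1)) < \<epsilon>"
      using xy by (simp add: dist_absv u_def v_def)
  qed (use \<epsilon> in auto)
qed

lemma has_volkenborn_integral_power: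
  "has_volkenborn_integral (\<lambda>x :: 'p :: prime_card padic. to_padic_complex x ^ m) (of_rat (bernoulli m))"
proof -
  define c where "c j = fact m / (fact j * fact (m + 1 - j)) * bernoulli j" for j
  have mean: "1 / of_nat (CARD('p) ^ N) * (\<Sum>x<CARD('p) ^ N. to_padic_complex (of_nat x :: 'p padic) ^ m) -
      of_rat (bernoulli m) = (\<Sum>j<m. of_rat (c j) * of_nat (CARD('p) ^ N) ^ (m - j))" for N
  proof -
    define q where "q = CARD('p) ^ N"
    have "q > 0"
      by (simp add: q_def)
    \<comment> \<open>Faulhaber's formula is an identity of rationals; \<open>of_rat\<close> carries
      it into C_p.\<close>
    have "1 / of_nat q * (\<Sum>x<q. of_nat x ^ m) = (of_rat (1 / of_nat q * (\<Sum>x<q. of_nat x ^ m)) :: 'p padic_complex)"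
      by (simp add: of_rat_mult of_rat_divide of_rat_sum of_rat_power)
    also have "\<dots> = of_rat (bernoulli m) + (\<Sum>j<m. of_rat (c j) * of_nat q ^ (m - j))"
      unfolding sum_powers_bernoulli [OF \<open>q > 0\<close>] c_def [symmetric]
      by (simp add: of_rat_mult of_rat_add of_rat_sum of_rat_power)
    finally show ?thesis
      by (simp add: q_def [symmetric] del: of_nat_power)
  qed
  \<comment> \<open>Since \<open>j < m\<close>, each term contains a positive power of
    \<open>CARD('p) ^ N\<close>.\<close>
  have "null_seq (\<lambda>N. \<Sum>j<m. of_rat (c j) * of_nat (CARD('p) ^ N) ^ (m - j) :: 'p padic_complex)"
    by (intro null_seq_sum null_seq_const_mult null_seq_CARD_power) auto
  thus ?thesis
    unfolding has_volkenborn_integral_def LIMSEQ_iff_null_seq mean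
    using uniformly_differentiable_power by blast
qed

section \<open>Products of Bernstein polynomials\<close>

lemma power_mult_one_minus_power_expand:
  fixes x :: "'a :: comm_ring_1"
  shows "x ^ a * (1 - x) ^ d = (\<Sum>l=0..d. (-1) ^ l * of_nat (d choose l) * x ^ (a + l))"
proof -
  \<comment> \<open>Written this way, the binomial theorem puts the powers on \<open>- x\<close>,
    which produces the signs.\<close>
  have "(1 - x) ^ d = (- x + 1) ^ d"
    by simp
  also have "\<dots> = (\<Sum>l=0..d. of_nat (d choose l) * (- x) ^ l)"
    by (subst binomial_ring) (simp add: atLeast0AtMost)
  finally show ?thesis
    by (simp add: sum_distrib_left power_add power_minus [of x] mult_ac)
qed

text \<open>All factors share the same \<open>k\<close>, so the binomial coefficients, the powers of
  \<open>x\<close> and those of \<open>1 - x\<close> can be collected separately.\<close>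

lemma prod_bernstein_power:
  fixes x :: "'a :: comm_ring_1"
  assumes "\<And>i. i \<in> A \<Longrightarrow> k \<le> n i"
  shows "(\<Prod>i\<in>A. bernstein k (n i) x ^ m i) =
    (\<Prod>i\<in>A. of_nat (n i choose k) ^ m i) *
      (x ^ (sum m A * k) * (1 - x) ^ ((\<Sum>i\<in>A. n i * m i) - sum m A * k))"
proof -
  \<comment> \<open>Subtraction here is truncated; \<open>k \<le> n i\<close> is what allows it to
    pass inside the sum.\<close>
  have "(\<Sum>i\<in>A. n i * m i) - sum m A * k = (\<Sum>i\<in>A. (n i - k) * m i)"
    unfolding sum_distrib_right diff_mult_distrib
    by (subst sum_subtractf_nat) (use assms in \<open>auto simp: mult.commute\<close>)
  thus ?thesis
    by (simp add: bernstein_def power_mult_distrib prod.distrib power_sum sum_distrib_right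
          mult.assoc mult.commute [of k] flip: power_mult)
qed

theorem mainTheorem5:
  fixes s k M D :: nat and n m :: "nat \<Rightarrow> nat"
  assumes "\<And>i. i \<in> {1..s} \<Longrightarrow> m i > 0"
    and "\<And>i. i \<in> {1..s} \<Longrightarrow> k \<le> n i"
    and "M = (\<Sum>i=1..s. m i)"
    and "D = (\<Sum>i=1..s. n i * m i) - M * k"
  shows "has_volkenborn_integral
     (\<lambda>x :: 'p :: prime_card padic. \<Prod>i=1..s. bernstein k (n i) (to_padic_complex x) ^ m i)
     ((\<Prod>i=1..s. of_nat (n i choose k) ^ m i) *
      (\<Sum>l=0..D. (-1) ^ l * of_nat (D choose l) * of_rat (bernoulli (M * k + l))))"
proof -
  have "(\<Prod>i=1..s. bernstein k (n i) x ^ m i) =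
      (\<Prod>i=1..s. of_nat (n i choose k) ^ m i) *
      (\<Sum>l=0..D. (-1) ^ l * of_nat (D choose l) * x ^ (M * k + l))" for x :: "'p padic_complex"
    \<comment> \<open>The alternating sum is folded back into a power of \<open>x\<close> times a
      power of \<open>1 - x\<close>.\<close>
    unfolding power_mult_one_minus_power_expand [symmetric] assms(3,4)
    by (rule prod_bernstein_power) (rule assms(2))
  \<comment> \<open>The linearity rules also carry uniform differentiability, which is part of
    \<open>has_volkenborn_integral\<close>.\<close>
  thus ?thesis
    by (simp only:) (intro has_volkenborn_integral_const_mult has_volkenborn_integral_sum
      has_volkenborn_integral_power)
qed

end
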